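(* Let $\mathrm{n}_1,\mathrm{n}_2,\mathrm{n}_p,\mathrm{n}_q\in\mathbb{N}^4$, and let $$\mathbf{G}_1=\{\mathcal{T}_1,\mathcal{T}_p,\mathcal{A}_1,\mathcal{B}_p,\mathcal{C}_q,\mathcal{D}_{qp}\},\qquad\mathbf{G}_2=\{\mathcal{T}_2,\mathcal{T}_q,\mathcal{A}_2,\mathcal{B}_q,\mathcal{C}_p,0\}$$ be collections of PI operators, where $\mathcal{T}_1,\mathcal{A}_1:\mathrm{Z}^{\mathrm{n}_1}\to\mathrm{Z}^{\mathrm{n}_1}$, $\mathcal{T}_p,\mathcal{B}_p:\mathrm{Z}^{\mathrm{n}_p}\to\mathrm{Z}^{\mathrm{n}_1}$, $\mathcal{C}_q:\mathrm{Z}^{\mathrm{n}_1}\to\mathrm{Z}^{\mathrm{n}_q}$, $\mathcal{D}_{qp}:\mathrm{Z}^{\mathrm{n}_p}\to\mathrm{Z}^{\mathrm{n}_q}$, $\mathcal{T}_2,\mathcal{A}_2:\mathrm{Z}^{\mathrm{n}_2}\to\mathrm{Z}^{\mathrm{n}_2}$, $\mathcal{T}_q,\mathcal{B}_q:\mathrm{Z}^{\mathrm{n}_q}\to\mathrm{Z}^{\mathrm{n}_2}$, $\mathcal{C}_p:\mathrm{Z}^{\mathrm{n}_2}\to\mathrm{Z}^{\mathrm{n}_p}$. Define the pair of PI operators $\mathbf{G}:=\{\mathcal{T},\mathcal{A}\}$ on $\mathrm{Z}^{\mathrm{n}_v}$, $\mathrm{n}_v=\mathrm{n}_1+\mathrm{n}_2$,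 by $$\mathcal{T}:=\begin{bmatrix}\mathcal{T}_1&\mathcal{T}_p\mathcal{C}_p\\ \mathcal{T}_q\mathcal{C}_q&\mathcal{T}_2+\mathcal{T}_q\mathcal{D}_{qp}\mathcal{C}_p\end{bmatrix},\qquad\mathcal{A}:=\begin{bmatrix}\mathcal{A}_1&\mathcal{B}_p\mathcal{C}_p\\ \mathcal{B}_q\mathcal{C}_q&\mathcal{A}_2+\mathcal{B}_q\mathcal{D}_{qp}\mathcal{C}_p\end{bmatrix}.$$ Then $\begin{bmatrix}\mathbf{v}\\ \boldsymbol\psi\end{bmatrix}$ solves the PIE defined by $\mathbf{G}$ with initial values $\begin{bmatrix}\mathbf{v}_0\\ \boldsymbol\psi_0\end{bmatrix}$ if and only if $(\mathbf{v},\mathbf{q})$ and $(\boldsymbol\psi,\mathbf{p})$ solve the PIEs defined by $\mathbf{G}_1$ and $\mathbf{G}_2$ with initial values $\mathbf{v}_0$ and $\boldsymbol\psi_0$ and inputs $\mathbf{p}$ and $\mathbf{q}$, respectively, where $$\mathbf{p}(t)=\mathcal{C}_p\boldsymbol\psi(t),\qquad\mathbf{q}(t)=\mathcal{C}_q\mathbf{v}(t)+\mathcal{D}_{qp}\mathbf{p}(t).$$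
   Context: Let $\Omega_1=[a,b]$, $\Omega_2=[c,d]$. For $\mathrm{n}=(n_0,n_1,n_2,n_3)\in\mathbb{N}^4$, $\mathrm{Z}^{\mathrm n}=\mathbb{R}^{n_0}\times L_2^{n_1}[\Omega_1]\times L_2^{n_2}[\Omega_2]\times L_2^{n_3}[\Omega_1\times\Omega_2]$. $\mathrm{Z}^{\mathrm{n}_1}\times\mathrm{Z}^{\mathrm{n}_2}$ is identified with $\mathrm{Z}^{\mathrm{n}_1+\mathrm{n}_2}$ by reordering components. PI operators. A 4-PI operator (in the variable $x\in\Omega_1$) is an operator mapping $(u_0,\mathbf{u}_1)\in\mathbb{R}^{n_0}\times L_2^{n_1}[\Omega_1]$ to $$\Bigl(B_{00}u_0+\int_a^bB_{01}(x)\mathbf{u}_1(x)dx,\ \ B_{10}(x)u_0+R_0(x)\mathbf{u}_1(x)+\int_a^xR_1(x,\theta)\mathbf{u}_1(\theta)d\theta+\int_x^bR_2(x,\theta)\mathbf{u}_1(\theta)d\theta\Bigr),$$ with $B_{00}$ a real matrix and matrix-valued functions $B_{01},B_{10}\in L_2[\Omega_1]$, $R_0\in L_\infty[\Omega_1]$, $R_1,R_2\in L_2[\Omega_1\times\Omega_1]$. A 4-PI operator also acts on pairs in $L_2^{n_2}[\Omega_2]\times L_2^{n_3}[\Omega_1\times\Omega_2]$, pointwise in the second variable $y\in\Omega_2$ (i.e. as a multiplier along $y$). Write an element of $\mathrm{Z}^{\mathrm n}$ as $(\mathbf{p}_1,\mathbf{p}_2)$ with $\mathbf{p}_1\in\mathbb{R}^{n_0}\times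 L_2^{n_1}[\Omega_1]$ and $\mathbf{p}_2\in L_2^{n_2}[\Omega_2]\times L_2^{n_3}[\Omega_1\times\Omega_2]$. A PI operator from $\mathrm{Z}^{\mathrm n}$ to $\mathrm{Z}^{\mathrm m}$ is an operator of the form $$(\mathbf{p}_1,\mathbf{p}_2)\mapsto\Bigl(\mathcal{B}_{11}\mathbf{p}_1+\int_c^d(\mathcal{B}_{12}\mathbf{p}_2)(y)dy,\ \ \mathcal{B}_{21}\mathbf{p}_1+(\mathcal{N}_0\mathbf{p}_2)(y)+\int_c^y(\mathcal{N}_1\mathbf{p}_2)(\nu)d\nu+\int_y^d(\mathcal{N}_2\mathbf{p}_2)(\nu)d\nu\Bigr),$$ where $\mathcal{B}_{11},\mathcal{B}_{12},\mathcal{B}_{21},\mathcal{N}_0,\mathcal{N}_1,\mathcal{N}_2$ are 4-PI operators of appropriate dimensions (with parameters not depending on $y,\nu$). PIEs. For PI operators $\mathbf{G}=\{\mathcal{T},\mathcal{T}_p,\mathcal{A},\mathcal{B},\mathcal{C},\mathcal{D}\}$ of compatible dimensions, the PIE (partial integral equation) defined by $\mathbf{G}$ with state $\mathbf{v}$, input $\mathbf{p}$ and output $\mathbf{q}$ (each valued in a space $\mathrm{Z}^{\mathrm n}$) is $$\mathcal{T}_p\mathbf{p}_t(t)+\mathcal{T}\mathbf{v}_t(t)=\mathcal{A}\mathbf{v}(t)+\mathcal{B}\mathbf{p}(t),\qquad\mathbf{q}(t)=\mathcal{C}\mathbf{v}(t)+\mathcal{D}\mathbf{p}(t).$$ For a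 given input signal $\mathbf{p}$ and initial state $\mathbf{v}_0$, $(\mathbf{v},\mathbf{q})$ is a solution if $\mathbf{v}$ is Fréchet differentiable, $\mathbf{v}(0)=\mathbf{v}_0$, and the two equations hold for all $t\ge0$. Without inputs and outputs, the PIE defined by $\{\mathcal{T},\mathcal{A}\}$ is $\mathcal{T}\mathbf{v}_t(t)=\mathcal{A}\mathbf{v}(t)$, with solutions defined in the same way.
   Formalization: T and A are defined as operators on Z^{n_v} but are not asserted to be PI operators: with parameters not depending on y, ν, compositions can leave the class (integrating twice from c to y gives the kernel y−ν). The equivalence itself is stated in full. *)

theory Defs
  imports "HOL-Analysis.Analysis" "HOL-Library.Poly_Mapping"
begin

section \<open>Square-integrable functions modulo equality almost everywhere\<close>

definition sq_integrable :: "('a::euclidean_space \<Rightarrow> real) \<Rightarrow> bool" where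
  "sq_integrable f \<longleftrightarrow> f \<in> borel_measurable lborel \<and> integrable lborel (\<lambda>x. (f x)\<^sup>2)"

definition lsq_rel :: "('a::euclidean_space \<Rightarrow> real) \<Rightarrow> ('a \<Rightarrow> real) \<Rightarrow> bool" where
  "lsq_rel f g \<longleftrightarrow> sq_integrable f \<and> sq_integrable g \<and> (AE x in lborel. f x = g x)"

lemma sq_integrable_zero: "sq_integrable (\<lambda>x. 0)"
  by (simp add: sq_integrable_def)

lemma sq_integrable_mult:
  assumes "sq_integrable f" "sq_integrable g"
  shows "integrable lborel (\<lambda>x. f x * g x)"
proof (rule Bochner_Integration.integrable_bound)
  show "integrable lborel (\<lambda>x. (f x)\<^sup>2 + (g x)\<^sup>2)"
    using assms by (auto simp: sq_integrable_def)
  show "(\<lambda>x. f x * g x) \<in> borel_measurable lborel"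
    using assms by (auto simp: sq_integrable_def)
  have "\<bar>s * t\<bar> \<le> \<bar>s\<^sup>2 + t\<^sup>2\<bar>" for s t :: real
  proof -
    have "0 \<le> (\<bar>s\<bar> - \<bar>t\<bar>)\<^sup>2" by simp
    then have "2 * \<bar>s * t\<bar> \<le> s\<^sup>2 + t\<^sup>2" by (simp add: power2_diff abs_mult)
    then show ?thesis by linarith
  qed
  then show "AE x in lborel. norm (f x * g x) \<le> norm ((f x)\<^sup>2 + (g x)\<^sup>2)"
    by simp
qed

lemma sq_integrable_add:
  assumes "sq_integrable f" "sq_integrable g"
  shows "sq_integrable (\<lambda>x. f x + g x)"
proof -
  have "integrable lborel (\<lambda>x. (f x)\<^sup>2 + (g x)\<^sup>2 + 2 * (f x * g x))"
    using assms sq_integrable_mult[OF assms] by (auto simp: sq_integrable_def)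
  then show ?thesis
    using assms by (auto simp: sq_integrable_def power2_sum algebra_simps)
qed

lemma sq_integrable_scale: "sq_integrable f \<Longrightarrow> sq_integrable (\<lambda>x. r * f x)"
  by (auto simp: sq_integrable_def power_mult_distrib)

lemma sq_integrable_uminus: "sq_integrable f \<Longrightarrow> sq_integrable (\<lambda>x. - f x)"
  by (auto simp: sq_integrable_def)

lemma sq_integrable_diff:
  "sq_integrable f \<Longrightarrow> sq_integrable g \<Longrightarrow> sq_integrable (\<lambda>x. f x - g x)"
  using sq_integrable_add[OF _ sq_integrable_uminus, of f g] by simp

lemma part_equivp_lsq_rel: "part_equivp (lsq_rel :: ('a::euclidean_space \<Rightarrow> real) \<Rightarrow> _)"
proof (rule part_equivpI)
  show "\<exists>f :: 'a \<Rightarrow> real. lsq_rel f f"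
    using sq_integrable_zero by (auto simp: lsq_rel_def)
  show "symp (lsq_rel :: ('a \<Rightarrow> real) \<Rightarrow> _)"
    by (auto simp: symp_def lsq_rel_def elim: eventually_mono)
  show "transp (lsq_rel :: ('a \<Rightarrow> real) \<Rightarrow> _)"
    unfolding transp_def lsq_rel_def by (auto elim: eventually_elim2)
qed

text \<open>
  For \<open>u :: 'a lsq\<close>, \<open>rep_lsq u\<close> is an arbitrary square-integrable representative; every use of it
  below is insensitive to changes on null sets.
\<close>

quotient_type (overloaded) 'a lsq = "'a::euclidean_space \<Rightarrow> real" / partial: lsq_rel
  morphisms rep_lsq abs_lsq
  by (rule part_equivp_lsq_rel)

instantiation lsq :: (euclidean_space) real_inner
begin

lift_definition zero_lsq :: "'a lsq" is "\<lambda>x. 0"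
  by (simp add: lsq_rel_def sq_integrable_zero)

lift_definition plus_lsq :: "'a lsq \<Rightarrow> 'a lsq \<Rightarrow> 'a lsq" is "\<lambda>f g x. f x + g x"
  unfolding lsq_rel_def by (auto intro: sq_integrable_add)

lift_definition uminus_lsq :: "'a lsq \<Rightarrow> 'a lsq" is "\<lambda>f x. - f x"
  unfolding lsq_rel_def by (auto intro: sq_integrable_uminus)

lift_definition minus_lsq :: "'a lsq \<Rightarrow> 'a lsq \<Rightarrow> 'a lsq" is "\<lambda>f g x. f x - g x"
  unfolding lsq_rel_def by (auto intro: sq_integrable_diff)

lift_definition scaleR_lsq :: "real \<Rightarrow> 'a lsq \<Rightarrow> 'a lsq" is "\<lambda>r f x. r * f x"
  unfolding lsq_rel_def by (auto intro: sq_integrable_scale)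

lift_definition inner_lsq :: "'a lsq \<Rightarrow> 'a lsq \<Rightarrow> real" is "\<lambda>f g. LINT x|lborel. f x * g x"
  unfolding lsq_rel_def
proof (elim conjE)
  fix f f' g g' :: "'a \<Rightarrow> real"
  assume sq: "sq_integrable f" "sq_integrable f'" "sq_integrable g" "sq_integrable g'"
    and eq: "AE x in lborel. f x = f' x" "AE x in lborel. g x = g' x"
  from eq have "AE x in lborel. f x * g x = f' x * g' x"
    by eventually_elim simp
  then show "(LINT x|lborel. f x * g x) = (LINT x|lborel. f' x * g' x)"
    using sq by (intro integral_cong_AE) (auto simp: sq_integrable_def)
qed

definition norm_lsq :: "'a lsq \<Rightarrow> real" where
  "norm_lsq u = sqrt (inner u u)"

definition sgn_lsq :: "'a lsq \<Rightarrow> 'a lsq" where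
  "sgn_lsq u = inverse (norm u) *\<^sub>R u"

definition dist_lsq :: "'a lsq \<Rightarrow> 'a lsq \<Rightarrow> real" where
  "dist_lsq u w = norm (u - w)"

definition uniformity_lsq :: "('a lsq \<times> 'a lsq) filter" where
  "uniformity_lsq = (INF e\<in>{0<..}. principal {(u, w). dist u w < e})"

definition open_lsq :: "'a lsq set \<Rightarrow> bool" where
  "open_lsq U \<longleftrightarrow> (\<forall>u\<in>U. eventually (\<lambda>(u', w). u' = u \<longrightarrow> w \<in> U) uniformity)"

instance
proof
  fix u v w :: "'a lsq" and r s :: real
  show "u + v + w = u + (v + w)"
    by transfer (auto simp: lsq_rel_def add.assoc intro!: sq_integrable_add)
  show "u + v = v + u"
    by transfer (auto simp: lsq_rel_def add.commute intro!: sq_integrable_add)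
  show "0 + u = u"
    by transfer (auto simp: lsq_rel_def)
  show "- u + u = 0"
    by transfer (auto simp: lsq_rel_def intro: sq_integrable_zero)
  show "u - v = u + - v"
    by transfer (auto simp: lsq_rel_def intro: sq_integrable_diff)
  show "r *\<^sub>R (u + v) = r *\<^sub>R u + r *\<^sub>R v"
    by transfer
      (auto simp: lsq_rel_def distrib_left intro!: sq_integrable_add sq_integrable_scale)
  show "(r + s) *\<^sub>R u = r *\<^sub>R u + s *\<^sub>R u"
    by transfer
      (auto simp: lsq_rel_def distrib_right intro!: sq_integrable_add sq_integrable_scale)
  show "r *\<^sub>R s *\<^sub>R u = (r * s) *\<^sub>R u"
    by transfer (auto simp: lsq_rel_def mult.assoc intro: sq_integrable_scale)
  show "1 *\<^sub>R u = u"
    by transfer (auto simp: lsq_rel_def)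
  show "sgn u = inverse (norm u) *\<^sub>R u"
    by (rule sgn_lsq_def)
  show "dist u v = norm (u - v)"
    by (rule dist_lsq_def)
  show "inner u v = inner v u"
    by transfer (simp add: mult.commute)
  show "inner (u + v) w = inner u w + inner v w"
    by transfer (simp add: lsq_rel_def distrib_right sq_integrable_mult)
  show "inner (r *\<^sub>R u) v = r * inner u v"
    by transfer (simp add: mult.assoc)
  show "0 \<le> inner u u"
    by transfer simp
  show "inner u u = 0 \<longleftrightarrow> u = 0"
    by transfer
      (subst integral_nonneg_eq_0_iff_AE,
        auto simp: lsq_rel_def sq_integrable_mult sq_integrable_zero)
  show "norm u = sqrt (inner u u)"
    by (rule norm_lsq_def)
next
  show "uniformity = (INF e\<in>{0<..}. principal {(u, w :: 'a lsq). dist u w < e})"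
    by (rule uniformity_lsq_def)
next
  fix U :: "'a lsq set"
  show "open U \<longleftrightarrow> (\<forall>u\<in>U. eventually (\<lambda>(u', w). u' = u \<longrightarrow> w \<in> U) uniformity)"
    by (rule open_lsq_def)
qed

end

text \<open>\<open>L2[S]\<close> is embedded in \<open>L2\<close> of the whole space by extension by zero.\<close>

definition lsq_on :: "'a::euclidean_space set \<Rightarrow> 'a lsq set" where
  "lsq_on S = {u. AE x in lborel. x \<notin> S \<longrightarrow> rep_lsq u x = 0}"


section \<open>Vectors of variable length\<close>

text \<open>
  Vectors whose length is a natural number (possibly 0) are finitely supported sequences, normed by
  the Euclidean norm; entries beyond the length are required to vanish.
\<close>

abbreviation "lookup \<equiv> Poly_Mapping.lookup"
abbreviation "keys \<equiv> Poly_Mapping.keys"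

instantiation poly_mapping :: (type, real_inner) real_inner
begin

lift_definition scaleR_poly_mapping :: "real \<Rightarrow> ('a \<Rightarrow>\<^sub>0 'b) \<Rightarrow> 'a \<Rightarrow>\<^sub>0 'b" is "\<lambda>r f i. r *\<^sub>R f i"
  by (rule finite_subset[rotated]) auto

definition inner_poly_mapping :: "('a \<Rightarrow>\<^sub>0 'b) \<Rightarrow> ('a \<Rightarrow>\<^sub>0 'b) \<Rightarrow> real" where
  "inner_poly_mapping f g = (\<Sum>i\<in>keys f. inner (lookup f i) (lookup g i))"

definition norm_poly_mapping :: "('a \<Rightarrow>\<^sub>0 'b) \<Rightarrow> real" where
  "norm_poly_mapping f = sqrt (inner f f)"

definition sgn_poly_mapping :: "('a \<Rightarrow>\<^sub>0 'b) \<Rightarrow> 'a \<Rightarrow>\<^sub>0 'b" where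
  "sgn_poly_mapping f = inverse (norm f) *\<^sub>R f"

definition dist_poly_mapping :: "('a \<Rightarrow>\<^sub>0 'b) \<Rightarrow> ('a \<Rightarrow>\<^sub>0 'b) \<Rightarrow> real" where
  "dist_poly_mapping f g = norm (f - g)"

definition uniformity_poly_mapping :: "(('a \<Rightarrow>\<^sub>0 'b) \<times> ('a \<Rightarrow>\<^sub>0 'b)) filter" where
  "uniformity_poly_mapping = (INF e\<in>{0<..}. principal {(f, g). dist f g < e})"

definition open_poly_mapping :: "('a \<Rightarrow>\<^sub>0 'b) set \<Rightarrow> bool" where
  "open_poly_mapping U \<longleftrightarrow> (\<forall>f\<in>U. eventually (\<lambda>(f', g). f' = f \<longrightarrow> g \<in> U) uniformity)"

lemma inner_poly_mapping_superset:
  fixes f g :: "'a \<Rightarrow>\<^sub>0 'b"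
  assumes "finite I" "keys f \<subseteq> I"
  shows "inner f g = (\<Sum>i\<in>I. inner (lookup f i) (lookup g i))"
  unfolding inner_poly_mapping_def
  by (rule sum.mono_neutral_left) (use assms in \<open>auto simp: in_keys_iff\<close>)

instance
proof
  fix f g h :: "'a \<Rightarrow>\<^sub>0 'b" and r s :: real
  show "r *\<^sub>R (f + g) = r *\<^sub>R f + r *\<^sub>R g"
    by transfer (simp add: scaleR_add_right)
  show "(r + s) *\<^sub>R f = r *\<^sub>R f + s *\<^sub>R f"
    by transfer (simp add: scaleR_add_left)
  show "r *\<^sub>R s *\<^sub>R f = (r * s) *\<^sub>R f"
    by transfer simp
  show "1 *\<^sub>R f = f"
    by transfer simp
  show "sgn f = inverse (norm f) *\<^sub>R f"
    by (rule sgn_poly_mapping_def)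
  show "dist f g = norm (f - g)"
    by (rule dist_poly_mapping_def)
  let ?I = "keys f \<union> keys g \<union> keys (f + g)"
  have I: "finite ?I" by simp
  have fg: "inner f h = (\<Sum>i\<in>?I. inner (lookup f i) (lookup h i))"
    "inner g h = (\<Sum>i\<in>?I. inner (lookup g i) (lookup h i))"
    "inner (f + g) h = (\<Sum>i\<in>?I. inner (lookup (f + g) i) (lookup h i))" for h
    by (rule inner_poly_mapping_superset, auto)+
  show "inner f g = inner g f"
    unfolding fg by (simp add: inner_commute)
  show "inner (f + g) h = inner f h + inner g h"
    unfolding fg by (simp add: lookup_add inner_add_left sum.distrib)
  have "keys (r *\<^sub>R f) \<subseteq> keys f"
    by transfer auto
  then have "inner (r *\<^sub>R f) g = (\<Sum>i\<in>keys f. inner (lookup (r *\<^sub>R f) i) (lookup g i))"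
    by (rule inner_poly_mapping_superset[rotated]) simp
  then show "inner (r *\<^sub>R f) g = r * inner f g"
    by (simp add: inner_poly_mapping_def scaleR_poly_mapping.rep_eq sum_distrib_left)
  show "0 \<le> inner f f"
    by (simp add: inner_poly_mapping_def sum_nonneg)
  show "inner f f = 0 \<longleftrightarrow> f = 0"
  proof
    assume "inner f f = 0"
    then have "\<forall>i\<in>keys f. lookup f i = 0"
      by (simp add: inner_poly_mapping_def sum_nonneg_eq_0_iff)
    then have "keys f = {}"
      by (meson equals0I in_keys_iff)
    then show "f = 0"
      by simp
  qed (simp add: inner_poly_mapping_def)
  show "norm f = sqrt (inner f f)"
    by (rule norm_poly_mapping_def)
next
  show "uniformity = (INF e\<in>{0<..}. principal {(f, g :: 'a \<Rightarrow>\<^sub>0 'b). dist f g < e})"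
    by (rule uniformity_poly_mapping_def)
next
  fix U :: "('a \<Rightarrow>\<^sub>0 'b) set"
  show "open U \<longleftrightarrow> (\<forall>f\<in>U. eventually (\<lambda>(f', g). f' = f \<longrightarrow> g \<in> U) uniformity)"
    by (rule open_poly_mapping_def)
qed

end

definition vecs :: "nat \<Rightarrow> 'b::zero set \<Rightarrow> (nat \<Rightarrow>\<^sub>0 'b) set" where
  "vecs n X = {u. keys u \<subseteq> {..<n} \<and> (\<forall>i<n. lookup u i \<in> X)}"

lift_definition vec_append :: "nat \<Rightarrow> (nat \<Rightarrow>\<^sub>0 'b::zero) \<Rightarrow> (nat \<Rightarrow>\<^sub>0 'b) \<Rightarrow> nat \<Rightarrow>\<^sub>0 'b"
  is "\<lambda>k u w i. if i < k then u i else w (i - k)"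
proof -
  fix k and u w :: "nat \<Rightarrow> 'b"
  assume fin: "finite {i. u i \<noteq> 0}" "finite {i. w i \<noteq> 0}"
  have "{i. (if i < k then u i else w (i - k)) \<noteq> 0} \<subseteq> {..<k} \<union> (\<lambda>i. i + k) ` {i. w i \<noteq> 0}"
  proof
    fix i
    assume "i \<in> {i. (if i < k then u i else w (i - k)) \<noteq> 0}"
    then show "i \<in> {..<k} \<union> (\<lambda>i. i + k) ` {i. w i \<noteq> 0}"
      by (cases "i < k") (auto intro: image_eqI[of _ _ "i - k"])
  qed
  then show "finite {i. (if i < k then u i else w (i - k)) \<noteq> 0}"
    by (rule finite_subset) (use fin in simp)
qed

lift_definition vec_take :: "nat \<Rightarrow> (nat \<Rightarrow>\<^sub>0 'b::zero) \<Rightarrow> nat \<Rightarrow>\<^sub>0 'b"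
  is "\<lambda>k u i. if i < k then u i else 0"
proof -
  fix k and u :: "nat \<Rightarrow> 'b"
  show "finite {i. (if i < k then u i else 0) \<noteq> 0}"
    by (rule finite_subset[of _ "{..<k}"]) (auto split: if_splits)
qed

lift_definition vec_drop :: "nat \<Rightarrow> (nat \<Rightarrow>\<^sub>0 'b::zero) \<Rightarrow> nat \<Rightarrow>\<^sub>0 'b"
  is "\<lambda>k u i. u (k + i)"
proof -
  fix k and u :: "nat \<Rightarrow> 'b"
  assume "finite {i. u i \<noteq> 0}"
  then have "finite ((\<lambda>i. k + i) -` {i. u i \<noteq> 0})"
    by (rule finite_vimageI) simp
  then show "finite {i. u (k + i) \<noteq> 0}"
    by (simp add: vimage_def)
qed


section \<open>The spaces \<open>Z\<close>\<close>

type_synonym dims = "nat \<times> nat \<times> nat \<times> nat"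

type_synonym zspace =
  "(nat \<Rightarrow>\<^sub>0 real) \<times> (nat \<Rightarrow>\<^sub>0 real lsq) \<times> (nat \<Rightarrow>\<^sub>0 real lsq) \<times> (nat \<Rightarrow>\<^sub>0 (real \<times> real) lsq)"

definition Z :: "real \<Rightarrow> real \<Rightarrow> real \<Rightarrow> real \<Rightarrow> dims \<Rightarrow> zspace set" where
  "Z a b c d = (\<lambda>(n0, n1, n2, n3).
     vecs n0 UNIV \<times> vecs n1 (lsq_on {a..b}) \<times> vecs n2 (lsq_on {c..d}) \<times>
     vecs n3 (lsq_on ({a..b} \<times> {c..d})))"

text \<open>The reordering of components that identifies \<open>Z n \<times> Z m\<close> with \<open>Z (n + m)\<close>, and its inverse.\<close>

definition z_join :: "dims \<Rightarrow> zspace \<Rightarrow> zspace \<Rightarrow> zspace" where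
  "z_join = (\<lambda>(n0, n1, n2, n3) (u0, u1, u2, u3) (w0, w1, w2, w3).
     (vec_append n0 u0 w0, vec_append n1 u1 w1, vec_append n2 u2 w2, vec_append n3 u3 w3))"

definition z_fst :: "dims \<Rightarrow> zspace \<Rightarrow> zspace" where
  "z_fst = (\<lambda>(n0, n1, n2, n3) (u0, u1, u2, u3).
     (vec_take n0 u0, vec_take n1 u1, vec_take n2 u2, vec_take n3 u3))"

definition z_snd :: "dims \<Rightarrow> zspace \<Rightarrow> zspace" where
  "z_snd = (\<lambda>(n0, n1, n2, n3) (u0, u1, u2, u3).
     (vec_drop n0 u0, vec_drop n1 u1, vec_drop n2 u2, vec_drop n3 u3))"

text \<open>The operator on \<open>Z (n + m)\<close> with block matrix \<open>[P11, P12; P21, P22]\<close>.\<close>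

definition z_block :: "dims \<Rightarrow> (zspace \<Rightarrow> zspace) \<Rightarrow> (zspace \<Rightarrow> zspace) \<Rightarrow>
    (zspace \<Rightarrow> zspace) \<Rightarrow> (zspace \<Rightarrow> zspace) \<Rightarrow> zspace \<Rightarrow> zspace" where
  "z_block n P11 P12 P21 P22 z =
     z_join n (P11 (z_fst n z) + P12 (z_snd n z)) (P21 (z_fst n z) + P22 (z_snd n z))"


section \<open>PI operators\<close>

definition L2_fun :: "'a::euclidean_space set \<Rightarrow> ('a \<Rightarrow> real) \<Rightarrow> bool" where
  "L2_fun S f \<longleftrightarrow> set_borel_measurable lborel S f \<and> set_integrable lborel S (\<lambda>x. (f x)\<^sup>2)"

definition Linf_fun :: "'a::euclidean_space set \<Rightarrow> ('a \<Rightarrow> real) \<Rightarrow> bool" where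
  "Linf_fun S f \<longleftrightarrow> set_borel_measurable lborel S f \<and>
     (\<exists>K. AE x in lborel. x \<in> S \<longrightarrow> \<bar>f x\<bar> \<le> K)"

text \<open>Matrix-valued parameters: the first two arguments are the row and column index.\<close>

record pi4_params =
  B00 :: "nat \<Rightarrow> nat \<Rightarrow> real"
  B01 :: "nat \<Rightarrow> nat \<Rightarrow> real \<Rightarrow> real"
  B10 :: "nat \<Rightarrow> nat \<Rightarrow> real \<Rightarrow> real"
  R0 :: "nat \<Rightarrow> nat \<Rightarrow> real \<Rightarrow> real"
  R1 :: "nat \<Rightarrow> nat \<Rightarrow> real \<Rightarrow> real \<Rightarrow> real"
  R2 :: "nat \<Rightarrow> nat \<Rightarrow> real \<Rightarrow> real \<Rightarrow> real"

text \<open>Parameters of a 4-PI operator from dimensions \<open>(n0, n1)\<close> to \<open>(m0, m1)\<close>.\<close>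

definition pi4_valid :: "real \<Rightarrow> real \<Rightarrow> nat \<times> nat \<Rightarrow> nat \<times> nat \<Rightarrow> pi4_params \<Rightarrow> bool" where
  "pi4_valid a b = (\<lambda>(n0, n1) (m0, m1) P.
     (\<forall>i<m0. \<forall>j<n1. L2_fun {a..b} (B01 P i j)) \<and>
     (\<forall>i<m1. \<forall>j<n0. L2_fun {a..b} (B10 P i j)) \<and>
     (\<forall>i<m1. \<forall>j<n1. Linf_fun {a..b} (R0 P i j) \<and>
        L2_fun ({a..b} \<times> {a..b}) (\<lambda>(x, \<theta>). R1 P i j x \<theta>) \<and>
        L2_fun ({a..b} \<times> {a..b}) (\<lambda>(x, \<theta>). R2 P i j x \<theta>)))"

text \<open>
  The two components of the image of \<open>(u0, u1)\<close>; entries of \<open>u0\<close>, \<open>u1\<close> at index \<open>n0\<close>, \<open>n1\<close> or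
  above are ignored.
\<close>

definition pi4_fin :: "real \<Rightarrow> real \<Rightarrow> nat \<times> nat \<Rightarrow> pi4_params \<Rightarrow>
    (nat \<Rightarrow> real) \<times> (nat \<Rightarrow> real \<Rightarrow> real) \<Rightarrow> nat \<Rightarrow> real" where
  "pi4_fin a b = (\<lambda>(n0, n1) P (u0, u1) i.
     (\<Sum>j<n0. B00 P i j * u0 j) +
     (LINT x:{a..b}|lborel. (\<Sum>j<n1. B01 P i j x * u1 j x)))"

definition pi4_dist :: "real \<Rightarrow> real \<Rightarrow> nat \<times> nat \<Rightarrow> pi4_params \<Rightarrow>
    (nat \<Rightarrow> real) \<times> (nat \<Rightarrow> real \<Rightarrow> real) \<Rightarrow> nat \<Rightarrow> real \<Rightarrow> real" where
  "pi4_dist a b = (\<lambda>(n0, n1) P (u0, u1) i x.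
     (\<Sum>j<n0. B10 P i j x * u0 j) + (\<Sum>j<n1. R0 P i j x * u1 j x) +
     (LINT \<theta>:{a..x}|lborel. (\<Sum>j<n1. R1 P i j x \<theta> * u1 j \<theta>)) +
     (LINT \<theta>:{x..b}|lborel. (\<Sum>j<n1. R2 P i j x \<theta> * u1 j \<theta>)))"

record pi_params =
  B11 :: pi4_params
  B12 :: pi4_params
  B21 :: pi4_params
  N0 :: pi4_params
  N1 :: pi4_params
  N2 :: pi4_params

definition pi_valid :: "real \<Rightarrow> real \<Rightarrow> dims \<Rightarrow> dims \<Rightarrow> pi_params \<Rightarrow> bool" where
  "pi_valid a b = (\<lambda>(n0, n1, n2, n3) (m0, m1, m2, m3) K.
     pi4_valid a b (n0, n1) (m0, m1) (B11 K) \<and>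
     pi4_valid a b (n2, n3) (m0, m1) (B12 K) \<and>
     pi4_valid a b (n0, n1) (m2, m3) (B21 K) \<and>
     pi4_valid a b (n2, n3) (m2, m3) (N0 K) \<and>
     pi4_valid a b (n2, n3) (m2, m3) (N1 K) \<and>
     pi4_valid a b (n2, n3) (m2, m3) (N2 K))"

text \<open>
  \<open>p1\<close> consists of the first two components of the argument; \<open>p2 y\<close> is the slice at \<open>y\<close> of the last
  two, on which 4-PI operators act pointwise in \<open>y\<close>. The output is specified up to null sets on the
  respective domains.
\<close>

definition pi_operator :: "real \<Rightarrow> real \<Rightarrow> real \<Rightarrow> real \<Rightarrow> dims \<Rightarrow> dims \<Rightarrow> (zspace \<Rightarrow> zspace) \<Rightarrow> bool"
  where
  "pi_operator a b c d = (\<lambda>(n0, n1, n2, n3) (m0, m1, m2, m3) P.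
     \<exists>K. pi_valid a b (n0, n1, n2, n3) (m0, m1, m2, m3) K \<and>
       (\<forall>(u0, u1, u2, u3) \<in> Z a b c d (n0, n1, n2, n3). \<exists>w0 w1 w2 w3.
          P (u0, u1, u2, u3) = (w0, w1, w2, w3) \<and>
          (w0, w1, w2, w3) \<in> Z a b c d (m0, m1, m2, m3) \<and>
          (let p1 = (lookup u0, \<lambda>j. rep_lsq (lookup u1 j));
               p2 = (\<lambda>y. (\<lambda>j. rep_lsq (lookup u2 j) y, \<lambda>j x. rep_lsq (lookup u3 j) (x, y)));
               fin1 = pi4_fin a b (n0, n1);
               dist1 = pi4_dist a b (n0, n1);
               fin2 = pi4_fin a b (n2, n3);
               dist2 = pi4_dist a b (n2, n3)
           in
             (\<forall>i<m0. lookup w0 i =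
                fin1 (B11 K) p1 i + (LINT y:{c..d}|lborel. fin2 (B12 K) (p2 y) i)) \<and>
             (\<forall>i<m1. AE x in lborel. x \<in> {a..b} \<longrightarrow> rep_lsq (lookup w1 i) x =
                dist1 (B11 K) p1 i x + (LINT y:{c..d}|lborel. dist2 (B12 K) (p2 y) i x)) \<and>
             (\<forall>i<m2. AE y in lborel. y \<in> {c..d} \<longrightarrow> rep_lsq (lookup w2 i) y =
                fin1 (B21 K) p1 i + fin2 (N0 K) (p2 y) i +
                (LINT \<nu>:{c..y}|lborel. fin2 (N1 K) (p2 \<nu>) i) +
                (LINT \<nu>:{y..d}|lborel. fin2 (N2 K) (p2 \<nu>) i)) \<and>
             (\<forall>i<m3. AE (x, y) in lborel. (x, y) \<in> {a..b} \<times> {c..d} \<longrightarrow>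
                rep_lsq (lookup w3 i) (x, y) =
                dist1 (B21 K) p1 i x + dist2 (N0 K) (p2 y) i x +
                (LINT \<nu>:{c..y}|lborel. dist2 (N1 K) (p2 \<nu>) i x) +
                (LINT \<nu>:{y..d}|lborel. dist2 (N2 K) (p2 \<nu>) i x)))))"


section \<open>Partial integral equations\<close>

record pie =
  op_T :: "zspace \<Rightarrow> zspace"
  op_Tp :: "zspace \<Rightarrow> zspace"
  op_A :: "zspace \<Rightarrow> zspace"
  op_B :: "zspace \<Rightarrow> zspace"
  op_C :: "zspace \<Rightarrow> zspace"
  op_D :: "zspace \<Rightarrow> zspace"

text \<open>The time derivative of a signal on \<open>[0,\<infinity>)\<close>, one-sided at 0.\<close>

definition time_deriv :: "(real \<Rightarrow> zspace) \<Rightarrow> real \<Rightarrow> zspace" where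
  "time_deriv v t = vector_derivative v (at t within {0..})"

text \<open>
  The state, input and output spaces are \<open>Z nv\<close>, \<open>Z np\<close> and \<open>Z nq\<close>. The term \<open>p\<^sub>t\<close> only
  makes sense if the input is differentiable, which is therefore part of the equation holding.
\<close>

definition pie_solution :: "real \<Rightarrow> real \<Rightarrow> real \<Rightarrow> real \<Rightarrow> dims \<Rightarrow> dims \<Rightarrow> dims \<Rightarrow> pie \<Rightarrow>
    (real \<Rightarrow> zspace) \<Rightarrow> zspace \<Rightarrow> (real \<Rightarrow> zspace) \<Rightarrow> (real \<Rightarrow> zspace) \<Rightarrow> bool" where
  "pie_solution a b c d nv np nq G p v0 v q \<longleftrightarrow>
     (\<forall>t\<ge>0. p t \<in> Z a b c d np) \<and> p differentiable_on {0..} \<and>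
     (\<forall>t\<ge>0. v t \<in> Z a b c d nv) \<and> v differentiable_on {0..} \<and>
     (\<forall>t\<ge>0. q t \<in> Z a b c d nq) \<and>
     v 0 = v0 \<and>
     (\<forall>t\<ge>0. op_Tp G (time_deriv p t) + op_T G (time_deriv v t) = op_A G (v t) + op_B G (p t) \<and>
            q t = op_C G (v t) + op_D G (p t))"

definition autonomous_pie_solution :: "real \<Rightarrow> real \<Rightarrow> real \<Rightarrow> real \<Rightarrow> dims \<Rightarrow>
    (zspace \<Rightarrow> zspace) \<Rightarrow> (zspace \<Rightarrow> zspace) \<Rightarrow> zspace \<Rightarrow> (real \<Rightarrow> zspace) \<Rightarrow> bool" where
  "autonomous_pie_solution a b c d nv T A v0 v \<longleftrightarrow>
     (\<forall>t\<ge>0. v t \<in> Z a b c d nv) \<and> v differentiable_on {0..} \<and>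
     v 0 = v0 \<and>
     (\<forall>t\<ge>0. T (time_deriv v t) = A (v t))"

end

theory Submission
  imports Defs
begin

text \<open>
  The interconnection is an algebraic identity once the internal signals can be differentiated. If
  \<open>p = Cp \<psi>\<close> and \<open>q = Cq v + Dqp p\<close> with bounded linear operators, then
  \<open>p' = Cp \<psi>'\<close> and \<open>q' = Cq v' + Dqp Cp \<psi>'\<close>; substituting these and using the linearity of \<open>Tq\<close> and
  \<open>Bq\<close>, the two rows of \<open>T\<close> and \<open>A\<close> become the dynamics of the two systems. The output equations
  hold by the choice of \<open>p\<close> and \<open>q\<close>, and the reordering \<open>z_join\<close> is bounded, linear and, on \<open>Z\<close>,
  inverted by bounded linear projections, so differentiability, initial values and equations may be treated
  componentwise.
  
  The work is in the premise. A PI operator is given by integral formulas on representatives of \<open>L2\<close>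
  classes, valid almost everywhere and for arguments in \<open>Z\<close> only. Its linearity needs the convergence
  of the integrals for almost all outer variables, and its boundedness needs Hilbert-Schmidt estimates;
  both come together in \<open>L2_map_kernel\<close>. The point measure \<open>pt\<close> and the exchange of the two variables
  make every term in the formulas a kernel operator or a bounded multiplier in one variable with the
  other as a parameter, so that \<open>pi_operator_bounded_linear_on\<close> follows by composition.
  
  Since the operators are unconstrained outside \<open>Z\<close>, derivatives must be shown to stay in \<open>Z\<close>. This
  holds because \<open>Z\<close> is closed (\<open>closed_Z\<close>): functions vanishing off a set form an orthogonal
  complement. The chain rule \<open>bounded_linear_on_has_vector_derivative\<close> then applies on \<open>Z\<close>.
\<close>


section \<open>Null sets and integrals on product spaces\<close>

text \<open>The exceptional set lies in the product of a measurable null set with the whole space.\<close>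

lemma AE_pair_fst:
  assumes "sigma_finite_measure M" "sigma_finite_measure N" "AE x in M. P x"
  shows "AE (x, y) in M \<Otimes>\<^sub>M N. P x"
proof -
  interpret pair_sigma_finite M N using assms by (simp add: pair_sigma_finite_def)
  from assms(3) obtain A where A: "A \<in> null_sets M" "{x\<in>space M. \<not> P x} \<subseteq> A"
    by (auto simp: eventually_ae_filter)
  then have [measurable]: "A \<in> sets M" by auto
  have "AE (x, y) in M \<Otimes>\<^sub>M N. x \<notin> A"
  proof (rule AE_pair_measure)
    show "{z \<in> space (M \<Otimes>\<^sub>M N). case z of (x, y) \<Rightarrow> x \<notin> A} \<in> sets (M \<Otimes>\<^sub>M N)" by measurable
    show "AE x in M. AE y in N. case (x, y) of (x, y) \<Rightarrow> x \<notin> A"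
      using AE_not_in[OF A(1)] by eventually_elim simp
  qed
  then show ?thesis
    using AE_space by eventually_elim (use A in \<open>auto simp: space_pair_measure\<close>)
qed

lemma AE_pair_snd:
  assumes "sigma_finite_measure M" "sigma_finite_measure N" "AE y in N. P y"
  shows "AE (x, y) in M \<Otimes>\<^sub>M N. P y"
proof -
  interpret pair_sigma_finite M N using assms by (simp add: pair_sigma_finite_def)
  from assms(3) obtain A where A: "A \<in> null_sets N" "{x\<in>space N. \<not> P x} \<subseteq> A"
    by (auto simp: eventually_ae_filter)
  then have [measurable]: "A \<in> sets N" by auto
  have "AE (x, y) in M \<Otimes>\<^sub>M N. y \<notin> A"
  proof (rule AE_pair_measure)
    show "{z \<in> space (M \<Otimes>\<^sub>M N). case z of (x, y) \<Rightarrow> y \<notin> A} \<in> sets (M \<Otimes>\<^sub>M N)" by measurable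
    show "AE x in M. AE y in N. case (x, y) of (x, y) \<Rightarrow> y \<notin> A"
      using AE_not_in[OF A(1)] by simp
  qed
  then show ?thesis
    using AE_space by eventually_elim (use A in \<open>auto simp: space_pair_measure\<close>)
qed

lemma AE_pair_swap:
  assumes "sigma_finite_measure M" "sigma_finite_measure N" "AE (x, y) in M \<Otimes>\<^sub>M N. P x y"
  shows "AE (y, x) in N \<Otimes>\<^sub>M M. P x y"
proof -
  interpret pair_sigma_finite M N using assms by (simp add: pair_sigma_finite_def)
  from assms(3) have "AE z in distr (N \<Otimes>\<^sub>M M) (M \<Otimes>\<^sub>M N) (\<lambda>(x, y). (y, x)). case z of (x, y) \<Rightarrow> P x y"
    by (subst distr_pair_swap[symmetric])
  from AE_distrD[OF _ this] show ?thesis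
    by (auto simp: case_prod_unfold)
qed

lemma nn_integral_pair_swap:
  assumes "sigma_finite_measure M" "sigma_finite_measure N"
    "case_prod f \<in> borel_measurable (M \<Otimes>\<^sub>M N)"
  shows "(\<integral>\<^sup>+(y, x). f x y \<partial>(N \<Otimes>\<^sub>M M)) = (\<integral>\<^sup>+(x, y). f x y \<partial>(M \<Otimes>\<^sub>M N))"
proof -
  interpret pair_sigma_finite M N using assms by (simp add: pair_sigma_finite_def)
  have "(\<integral>\<^sup>+z. case_prod f z \<partial>distr (N \<Otimes>\<^sub>M M) (M \<Otimes>\<^sub>M N) (\<lambda>(x, y). (y, x))) =
    (\<integral>\<^sup>+z. case_prod f (case z of (x, y) \<Rightarrow> (y, x)) \<partial>(N \<Otimes>\<^sub>M M))"
    by (rule nn_integral_distr) (use assms in auto)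
  then show ?thesis by (subst distr_pair_swap) (simp add: case_prod_unfold)
qed

text \<open>
  Cauchy-Schwarz for the Bochner integral. The bound holds even if the product is not integrable,
  because its integral is then 0 by convention.
\<close>

lemma ennreal_square_integral_mult_le:
  fixes f g :: "'a \<Rightarrow> real"
  assumes [measurable]: "f \<in> borel_measurable M" "g \<in> borel_measurable M"
  shows "ennreal ((\<integral>x. f x * g x \<partial>M)\<^sup>2) \<le> (\<integral>\<^sup>+x. ennreal ((f x)\<^sup>2) \<partial>M) * (\<integral>\<^sup>+x. ennreal ((g x)\<^sup>2) \<partial>M)"
    and "(\<integral>\<^sup>+x. ennreal ((f x)\<^sup>2) \<partial>M) < \<infinity> \<Longrightarrow> (\<integral>\<^sup>+x. ennreal ((g x)\<^sup>2) \<partial>M) < \<infinity> \<Longrightarrow>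
      integrable M (\<lambda>x. f x * g x)"
proof -
  let ?I = "\<integral>\<^sup>+x. ennreal (norm (f x * g x)) \<partial>M"
  let ?A = "\<integral>\<^sup>+x. ennreal ((f x)\<^sup>2) \<partial>M" and ?B = "\<integral>\<^sup>+x. ennreal ((g x)\<^sup>2) \<partial>M"
  have *: "?I\<^sup>2 \<le> ?A * ?B"
    using Cauchy_Schwarz_nn_integral[of "\<lambda>x. ennreal \<bar>f x\<bar>" M "\<lambda>x. ennreal \<bar>g x\<bar>"]
    by (simp add: ennreal_mult' abs_mult ennreal_power)
  have "ennreal (norm (\<integral>x. f x * g x \<partial>M)) \<le> ?I"
    using integral_norm_bound_ennreal[of M "\<lambda>x. f x * g x"]
      not_integrable_integral_eq[of M "\<lambda>x. f x * g x"] by fastforce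
  then have "(ennreal (norm (\<integral>x. f x * g x \<partial>M)))\<^sup>2 \<le> ?I\<^sup>2"
    by (rule power_mono) simp
  with * show "ennreal ((\<integral>x. f x * g x \<partial>M)\<^sup>2) \<le> ?A * ?B"
    by (simp add: ennreal_power)
  assume "?A < \<infinity>" "?B < \<infinity>"
  then have "?I\<^sup>2 < \<infinity>" using * by (simp add: ennreal_mult_less_top le_less_trans)
  then have "?I < \<infinity>"
    by (cases "?I = \<infinity>") (auto simp: power2_eq_square ennreal_top_mult less_top[symmetric])
  then show "integrable M (\<lambda>x. f x * g x)"
    by (intro integrableI_bounded) auto
qed


section \<open>Bounded linear maps into \<open>L2\<close> of a product\<close>

text \<open>
  A map \<open>F\<close> from \<open>V\<close> to functions of two variables that induces a bounded linear map from \<open>V\<close> to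
  \<open>L2 (M \<Otimes> N)\<close>. It takes values in functions, not classes, because the PI operators are built from
  pointwise operations on representatives; linearity can then hold only up to a null set, which may
  depend on the arguments. Keeping the two variables apart lets an operator act on one of them while
  the other is a parameter.
\<close>

definition L2_map ::
  "'v::real_normed_vector set \<Rightarrow> 'a measure \<Rightarrow> 'b measure \<Rightarrow> ('v \<Rightarrow> 'a \<Rightarrow> 'b \<Rightarrow> real) \<Rightarrow> bool" where
  "L2_map V M N F \<longleftrightarrow>
     (\<forall>u\<in>V. case_prod (F u) \<in> borel_measurable (M \<Otimes>\<^sub>M N)) \<and>
     (\<forall>u\<in>V. \<forall>w\<in>V. \<forall>r. AE (x, y) in M \<Otimes>\<^sub>M N. F (u + r *\<^sub>R w) x y = F u x y + r * F w x y) \<and>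
     (\<exists>C\<ge>0. \<forall>u\<in>V. (\<integral>\<^sup>+(x, y). ennreal ((F u x y)\<^sup>2) \<partial>(M \<Otimes>\<^sub>M N)) \<le> ennreal (C * (norm u)\<^sup>2))"

definition L2_kernel :: "'a measure \<Rightarrow> 'b measure \<Rightarrow> ('a \<Rightarrow> 'b \<Rightarrow> real) \<Rightarrow> bool" where
  "L2_kernel M N k \<longleftrightarrow>
     case_prod k \<in> borel_measurable (M \<Otimes>\<^sub>M N) \<and> (\<integral>\<^sup>+(x, y). ennreal ((k x y)\<^sup>2) \<partial>(M \<Otimes>\<^sub>M N)) < \<infinity>"

lemma L2_mapI:
  assumes "\<And>u. u \<in> V \<Longrightarrow> case_prod (F u) \<in> borel_measurable (M \<Otimes>\<^sub>M N)"
    and "\<And>u w r. u \<in> V \<Longrightarrow> w \<in> V \<Longrightarrow>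
      AE (x, y) in M \<Otimes>\<^sub>M N. F (u + r *\<^sub>R w) x y = F u x y + r * F w x y"
    and "0 \<le> C"
    and "\<And>u. u \<in> V \<Longrightarrow>
      (\<integral>\<^sup>+(x, y). ennreal ((F u x y)\<^sup>2) \<partial>(M \<Otimes>\<^sub>M N)) \<le> ennreal (C * (norm u)\<^sup>2)"
  shows "L2_map V M N F"
  using assms unfolding L2_map_def by blast

lemma L2_mapE:
  assumes "L2_map V M N F"
  obtains C where "\<And>u. u \<in> V \<Longrightarrow> case_prod (F u) \<in> borel_measurable (M \<Otimes>\<^sub>M N)"
    and "\<And>u w r. u \<in> V \<Longrightarrow> w \<in> V \<Longrightarrow>
      AE (x, y) in M \<Otimes>\<^sub>M N. F (u + r *\<^sub>R w) x y = F u x y + r * F w x y"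
    and "0 \<le> C"
    and "\<And>u. u \<in> V \<Longrightarrow>
      (\<integral>\<^sup>+(x, y). ennreal ((F u x y)\<^sup>2) \<partial>(M \<Otimes>\<^sub>M N)) \<le> ennreal (C * (norm u)\<^sup>2)"
  using assms unfolding L2_map_def by blast

lemma L2_map_measurable:
  "L2_map V M N F \<Longrightarrow> u \<in> V \<Longrightarrow> case_prod (F u) \<in> borel_measurable (M \<Otimes>\<^sub>M N)"
  by (auto simp: L2_map_def)

lemma L2_map_swap:
  assumes "sigma_finite_measure M" "sigma_finite_measure N" "L2_map V M N F"
  shows "L2_map V N M (\<lambda>u y x. F u x y)"
proof -
  from assms(3) obtain C where F: "\<And>u. u \<in> V \<Longrightarrow> case_prod (F u) \<in> borel_measurable (M \<Otimes>\<^sub>M N)"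
    "\<And>u w r. u \<in> V \<Longrightarrow> w \<in> V \<Longrightarrow>
      AE (x, y) in M \<Otimes>\<^sub>M N. F (u + r *\<^sub>R w) x y = F u x y + r * F w x y"
    "0 \<le> C" "\<And>u. u \<in> V \<Longrightarrow>
      (\<integral>\<^sup>+(x, y). ennreal ((F u x y)\<^sup>2) \<partial>(M \<Otimes>\<^sub>M N)) \<le> ennreal (C * (norm u)\<^sup>2)"
    by (rule L2_mapE) (rule that)
  show ?thesis
  proof (rule L2_mapI[where C = C])
    fix u assume u: "u \<in> V"
    note [measurable] = F(1)[OF u]
    show "(\<lambda>(y, x). F u x y) \<in> borel_measurable (N \<Otimes>\<^sub>M M)"
      using measurable_pair_swap[OF F(1)[OF u]] by simp
    have "(\<lambda>(x, y). ennreal ((F u x y)\<^sup>2)) \<in> borel_measurable (M \<Otimes>\<^sub>M N)"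
      using F(1)[OF u] by (auto simp: case_prod_unfold)
    from nn_integral_pair_swap[OF assms(1,2) this]
    show "(\<integral>\<^sup>+(y, x). ennreal ((F u x y)\<^sup>2) \<partial>(N \<Otimes>\<^sub>M M)) \<le> ennreal (C * (norm u)\<^sup>2)"
      using F(4)[OF u] by simp
  qed (use AE_pair_swap[OF assms(1,2) F(2)] F(3) in auto)
qed

lemma sq_add_le: "((s::real) + t)\<^sup>2 \<le> 2 * (s\<^sup>2 + t\<^sup>2)"
  using sum_squares_bound[of s t] by (simp add: power2_sum)

lemma L2_map_add:
  assumes "L2_map V M N F" "L2_map V M N G"
  shows "L2_map V M N (\<lambda>u x y. F u x y + G u x y)"
proof -
  from assms(1) obtain C where F: "\<And>u. u \<in> V \<Longrightarrow> case_prod (F u) \<in> borel_measurable (M \<Otimes>\<^sub>M N)"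
    "\<And>u w r. u \<in> V \<Longrightarrow> w \<in> V \<Longrightarrow>
      AE (x, y) in M \<Otimes>\<^sub>M N. F (u + r *\<^sub>R w) x y = F u x y + r * F w x y"
    "0 \<le> C" "\<And>u. u \<in> V \<Longrightarrow>
      (\<integral>\<^sup>+(x, y). ennreal ((F u x y)\<^sup>2) \<partial>(M \<Otimes>\<^sub>M N)) \<le> ennreal (C * (norm u)\<^sup>2)"
    by (rule L2_mapE) (rule that)
  from assms(2) obtain D where G: "\<And>u. u \<in> V \<Longrightarrow> case_prod (G u) \<in> borel_measurable (M \<Otimes>\<^sub>M N)"
    "\<And>u w r. u \<in> V \<Longrightarrow> w \<in> V \<Longrightarrow>
      AE (x, y) in M \<Otimes>\<^sub>M N. G (u + r *\<^sub>R w) x y = G u x y + r * G w x y"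
    "0 \<le> D" "\<And>u. u \<in> V \<Longrightarrow>
      (\<integral>\<^sup>+(x, y). ennreal ((G u x y)\<^sup>2) \<partial>(M \<Otimes>\<^sub>M N)) \<le> ennreal (D * (norm u)\<^sup>2)"
    by (rule L2_mapE) (rule that)
  show ?thesis
  proof (rule L2_mapI[where C = "2 * (C + D)"])
    fix u assume u: "u \<in> V"
    note [measurable] = F(1)[OF u] G(1)[OF u]
    show "(\<lambda>(x, y). F u x y + G u x y) \<in> borel_measurable (M \<Otimes>\<^sub>M N)"
      using F(1)[OF u] G(1)[OF u] by (simp add: case_prod_unfold)
    have "(\<integral>\<^sup>+(x, y). ennreal ((F u x y + G u x y)\<^sup>2) \<partial>(M \<Otimes>\<^sub>M N)) \<le>
        (\<integral>\<^sup>+z. 2 * (ennreal ((case_prod (F u) z)\<^sup>2) + ennreal ((case_prod (G u) z)\<^sup>2)) \<partial>(M \<Otimes>\<^sub>M N))"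
      by (rule nn_integral_mono)
        (auto simp: ennreal_plus[symmetric] ennreal_mult'[symmetric] numeral_mult_ennreal
          simp del: ennreal_plus intro!: ennreal_leI sq_add_le[simplified distrib_left])
    also have "\<dots> = 2 * ((\<integral>\<^sup>+z. ennreal ((case_prod (F u) z)\<^sup>2) \<partial>(M \<Otimes>\<^sub>M N)) +
        (\<integral>\<^sup>+z. ennreal ((case_prod (G u) z)\<^sup>2) \<partial>(M \<Otimes>\<^sub>M N)))"
      by (simp add: nn_integral_cmult nn_integral_add)
    also have "\<dots> \<le> 2 * (ennreal (C * (norm u)\<^sup>2) + ennreal (D * (norm u)\<^sup>2))"
      using F(4)[OF u] G(4)[OF u] by (intro mult_left_mono add_mono) (auto simp: case_prod_unfold)
    also have "\<dots> = ennreal (2 * (C + D) * (norm u)\<^sup>2)"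
      using F(3) G(3)
      by (simp add: ennreal_plus[symmetric] numeral_mult_ennreal algebra_simps del: ennreal_plus)
    finally show "(\<integral>\<^sup>+(x, y). ennreal ((F u x y + G u x y)\<^sup>2) \<partial>(M \<Otimes>\<^sub>M N)) \<le>
        ennreal (2 * (C + D) * (norm u)\<^sup>2)" .
  next
    fix u w r assume uw: "u \<in> V" "w \<in> V"
    show "AE (x, y) in M \<Otimes>\<^sub>M N. F (u + r *\<^sub>R w) x y + G (u + r *\<^sub>R w) x y =
        F u x y + G u x y + r * (F w x y + G w x y)"
      using F(2)[OF uw, of r] G(2)[OF uw, of r] by eventually_elim (auto simp: algebra_simps)
  qed (use F(3) G(3) in auto)
qed

lemma L2_map_zero: "L2_map V M N (\<lambda>u x y. 0)"
  by (rule L2_mapI[where C = 0]) (auto simp: case_prod_unfold)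

lemma L2_map_sum:
  assumes "\<And>j. j \<in> J \<Longrightarrow> L2_map V M N (F j)"
  shows "L2_map V M N (\<lambda>u x y. \<Sum>j\<in>J. F j u x y)"
  using assms
  by (induction J rule: infinite_finite_induct) (auto intro: L2_map_zero L2_map_add)

text \<open>
  Pointwise formulas with a sum inside an integral agree with the sum of the integrals only where
  the summands are integrable, that is, almost everywhere.
\<close>

lemma L2_map_cong_AE:
  assumes V: "subspace V" and F: "L2_map V M N F"
    and m: "\<And>u. u \<in> V \<Longrightarrow> case_prod (G u) \<in> borel_measurable (M \<Otimes>\<^sub>M N)"
    and eq: "\<And>u. u \<in> V \<Longrightarrow> AE (x, y) in M \<Otimes>\<^sub>M N. G u x y = F u x y"
  shows "L2_map V M N G"
proof -
  from F obtain C where F: "\<And>u. u \<in> V \<Longrightarrow> case_prod (F u) \<in> borel_measurable (M \<Otimes>\<^sub>M N)"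
    "\<And>u w r. u \<in> V \<Longrightarrow> w \<in> V \<Longrightarrow>
      AE (x, y) in M \<Otimes>\<^sub>M N. F (u + r *\<^sub>R w) x y = F u x y + r * F w x y"
    "0 \<le> C" "\<And>u. u \<in> V \<Longrightarrow>
      (\<integral>\<^sup>+(x, y). ennreal ((F u x y)\<^sup>2) \<partial>(M \<Otimes>\<^sub>M N)) \<le> ennreal (C * (norm u)\<^sup>2)"
    by (rule L2_mapE) (rule that)
  show ?thesis
  proof (rule L2_mapI[OF m _ F(3)])
    fix u w r assume uw: "u \<in> V" "w \<in> V"
    then have "u + r *\<^sub>R w \<in> V" using V by (simp add: subspace_add subspace_scale)
    from eq[OF this] eq[OF uw(1)] eq[OF uw(2)] F(2)[OF uw, of r]
    show "AE (x, y) in M \<Otimes>\<^sub>M N. G (u + r *\<^sub>R w) x y = G u x y + r * G w x y"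
      by eventually_elim auto
  next
    fix u assume u: "u \<in> V"
    have "(\<integral>\<^sup>+(x, y). ennreal ((G u x y)\<^sup>2) \<partial>(M \<Otimes>\<^sub>M N)) = (\<integral>\<^sup>+(x, y). ennreal ((F u x y)\<^sup>2) \<partial>(M \<Otimes>\<^sub>M N))"
      by (rule nn_integral_cong_AE) (use eq[OF u] in \<open>eventually_elim, auto\<close>)
    then show "(\<integral>\<^sup>+(x, y). ennreal ((G u x y)\<^sup>2) \<partial>(M \<Otimes>\<^sub>M N)) \<le> ennreal (C * (norm u)\<^sup>2)"
      using F(4)[OF u] by simp
  qed auto
qed

lemma L2_map_mult:
  assumes F: "L2_map V M N F" and "sigma_finite_measure M" "sigma_finite_measure N"
    and m: "m \<in> borel_measurable M" and K: "AE x in M. \<bar>m x\<bar> \<le> K"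
  shows "L2_map V M N (\<lambda>u x y. m x * F u x y)"
proof -
  from F obtain C where F: "\<And>u. u \<in> V \<Longrightarrow> case_prod (F u) \<in> borel_measurable (M \<Otimes>\<^sub>M N)"
    "\<And>u w r. u \<in> V \<Longrightarrow> w \<in> V \<Longrightarrow>
      AE (x, y) in M \<Otimes>\<^sub>M N. F (u + r *\<^sub>R w) x y = F u x y + r * F w x y"
    "0 \<le> C" "\<And>u. u \<in> V \<Longrightarrow>
      (\<integral>\<^sup>+(x, y). ennreal ((F u x y)\<^sup>2) \<partial>(M \<Otimes>\<^sub>M N)) \<le> ennreal (C * (norm u)\<^sup>2)"
    by (rule L2_mapE) (rule that)
  show ?thesis
  proof (rule L2_mapI[where C = "K\<^sup>2 * C"])
    fix u assume u: "u \<in> V"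
    note [measurable] = F(1)[OF u] m
    show "(\<lambda>(x, y). m x * F u x y) \<in> borel_measurable (M \<Otimes>\<^sub>M N)"
      using F(1)[OF u] by (simp add: case_prod_unfold)
    have "(\<integral>\<^sup>+(x, y). ennreal ((m x * F u x y)\<^sup>2) \<partial>(M \<Otimes>\<^sub>M N)) \<le>
        (\<integral>\<^sup>+z. ennreal (K\<^sup>2) * ennreal ((case_prod (F u) z)\<^sup>2) \<partial>(M \<Otimes>\<^sub>M N))"
    proof (rule nn_integral_mono_AE)
      show "AE z in M \<Otimes>\<^sub>M N. (case z of (x, y) \<Rightarrow> ennreal ((m x * F u x y)\<^sup>2)) \<le>
          ennreal (K\<^sup>2) * ennreal ((case_prod (F u) z)\<^sup>2)"
        using AE_pair_fst[OF assms(2,3) K]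
      proof eventually_elim
        case (elim z)
        then have "(m (fst z))\<^sup>2 \<le> K\<^sup>2"
          by (auto simp: case_prod_unfold abs_le_square_iff[symmetric])
        then show ?case
          by (auto simp: case_prod_unfold ennreal_mult'[symmetric] power_mult_distrib
            intro!: ennreal_leI mult_right_mono)
      qed
    qed
    also have "\<dots> = ennreal (K\<^sup>2) * (\<integral>\<^sup>+z. ennreal ((case_prod (F u) z)\<^sup>2) \<partial>(M \<Otimes>\<^sub>M N))"
      by (simp add: nn_integral_cmult)
    also have "\<dots> \<le> ennreal (K\<^sup>2) * ennreal (C * (norm u)\<^sup>2)"
      using F(4)[OF u] by (intro mult_left_mono) (auto simp: case_prod_unfold)
    also have "\<dots> = ennreal (K\<^sup>2 * C * (norm u)\<^sup>2)"
      using F(3) by (simp add: ennreal_mult'[symmetric] mult.assoc)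
    finally show "(\<integral>\<^sup>+(x, y). ennreal ((m x * F u x y)\<^sup>2) \<partial>(M \<Otimes>\<^sub>M N)) \<le>
        ennreal (K\<^sup>2 * C * (norm u)\<^sup>2)" .
  next
    fix u w r assume uw: "u \<in> V" "w \<in> V"
    show "AE (x, y) in M \<Otimes>\<^sub>M N. m x * F (u + r *\<^sub>R w) x y = m x * F u x y + r * (m x * F w x y)"
      using F(2)[OF uw, of r] by eventually_elim (auto simp: algebra_simps)
  qed (use F(3) in auto)
qed


section \<open>Kernel operators\<close>

text \<open>
  A Hilbert-Schmidt operator in the first variable, with the second as a parameter. For almost all
  \<open>(x, y)\<close> the slices \<open>k x\<close> and \<open>F u _ y\<close> are square-integrable, so the integral converges and is
  additive; integrating the Cauchy-Schwarz bound over \<open>x\<close> and \<open>y\<close> gives the product of the squared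
  norms of \<open>k\<close> and \<open>F u\<close>.
\<close>

lemma L2_map_kernel:
  assumes V: "subspace V"
    and sf: "sigma_finite_measure M1" "sigma_finite_measure M2" "sigma_finite_measure M3"
    and k: "L2_kernel M1 M2 k" and F: "L2_map V M2 M3 F"
  shows "L2_map V M1 M3 (\<lambda>u x y. \<integral>\<theta>. k x \<theta> * F u \<theta> y \<partial>M2)"
    and "u \<in> V \<Longrightarrow> AE (x, y) in M1 \<Otimes>\<^sub>M M3. integrable M2 (\<lambda>\<theta>. k x \<theta> * F u \<theta> y)"
proof -
  interpret M1: sigma_finite_measure M1 by fact
  interpret M2: sigma_finite_measure M2 by fact
  interpret M3: sigma_finite_measure M3 by fact
  interpret M12: pair_sigma_finite M1 M2 ..
  interpret M32: pair_sigma_finite M3 M2 ..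
  interpret M13: pair_sigma_finite M1 M3 ..
  from F obtain C where F: "\<And>u. u \<in> V \<Longrightarrow> case_prod (F u) \<in> borel_measurable (M2 \<Otimes>\<^sub>M M3)"
    "\<And>u w r. u \<in> V \<Longrightarrow> w \<in> V \<Longrightarrow>
      AE (x, y) in M2 \<Otimes>\<^sub>M M3. F (u + r *\<^sub>R w) x y = F u x y + r * F w x y"
    "0 \<le> C" "\<And>u. u \<in> V \<Longrightarrow>
      (\<integral>\<^sup>+(x, y). ennreal ((F u x y)\<^sup>2) \<partial>(M2 \<Otimes>\<^sub>M M3)) \<le> ennreal (C * (norm u)\<^sup>2)"
    by (rule L2_mapE) (rule that)
  have km: "case_prod k \<in> borel_measurable (M1 \<Otimes>\<^sub>M M2)"
    and kfin: "(\<integral>\<^sup>+(x, y). ennreal ((k x y)\<^sup>2) \<partial>(M1 \<Otimes>\<^sub>M M2)) < \<infinity>"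
    using k by (auto simp: L2_kernel_def)
  define K where "K x = (\<integral>\<^sup>+\<theta>. ennreal ((k x \<theta>)\<^sup>2) \<partial>M2)" for x
  define N where "N u y = (\<integral>\<^sup>+\<theta>. ennreal ((F u \<theta> y)\<^sup>2) \<partial>M2)" for u y
  have ksq: "(\<lambda>(x, \<theta>). ennreal ((k x \<theta>)\<^sup>2)) \<in> borel_measurable (M1 \<Otimes>\<^sub>M M2)"
    using km by (auto simp: case_prod_unfold)
  have K_meas [measurable]: "K \<in> borel_measurable M1"
    unfolding K_def using ksq by (rule M2.borel_measurable_nn_integral)
  have K_int: "(\<integral>\<^sup>+x. K x \<partial>M1) = (\<integral>\<^sup>+(x, y). ennreal ((k x y)\<^sup>2) \<partial>(M1 \<Otimes>\<^sub>M M2))"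
    unfolding K_def using M2.nn_integral_fst[OF ksq] by simp
  have Fsq: "(\<lambda>(y, \<theta>). ennreal ((F u \<theta> y)\<^sup>2)) \<in> borel_measurable (M3 \<Otimes>\<^sub>M M2)" if "u \<in> V" for u
    using measurable_pair_swap[OF F(1)[OF that]] by (auto simp: case_prod_unfold)
  have N_meas: "N u \<in> borel_measurable M3" if "u \<in> V" for u
    unfolding N_def using Fsq[OF that] by (rule M2.borel_measurable_nn_integral)
  have N_int: "(\<integral>\<^sup>+y. N u y \<partial>M3) \<le> ennreal (C * (norm u)\<^sup>2)" if "u \<in> V" for u
  proof -
    have "(\<integral>\<^sup>+y. N u y \<partial>M3) = (\<integral>\<^sup>+(y, \<theta>). ennreal ((F u \<theta> y)\<^sup>2) \<partial>(M3 \<Otimes>\<^sub>M M2))"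
      unfolding N_def using M2.nn_integral_fst[OF Fsq[OF that]] by simp
    also have "\<dots> = (\<integral>\<^sup>+(\<theta>, y). ennreal ((F u \<theta> y)\<^sup>2) \<partial>(M2 \<Otimes>\<^sub>M M3))"
      by (rule nn_integral_pair_swap) (use F(1)[OF that] sf in \<open>auto simp: case_prod_unfold\<close>)
    also have "\<dots> \<le> ennreal (C * (norm u)\<^sup>2)" by (rule F(4)[OF that])
    finally show ?thesis .
  qed
  have k_slice: "AE x in M1. k x \<in> borel_measurable M2 \<and> K x < \<infinity>"
  proof -
    have "AE x in M1. K x \<noteq> \<infinity>"
      by (rule nn_integral_PInf_AE) (use kfin in \<open>auto simp: K_int\<close>)
    with AE_space show ?thesis
      by eventually_elim (use km in \<open>auto simp: less_top\<close>)
  qed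
  have F_slice: "AE y in M3. (\<lambda>\<theta>. F u \<theta> y) \<in> borel_measurable M2 \<and> N u y < \<infinity>" if "u \<in> V" for u
  proof -
    have "(\<integral>\<^sup>+y. N u y \<partial>M3) < \<infinity>"
      by (rule le_less_trans[OF N_int[OF that]]) simp
    then have "AE y in M3. N u y \<noteq> \<infinity>"
      by (intro nn_integral_PInf_AE N_meas[OF that]) simp
    with AE_space show ?thesis
      by eventually_elim (use F(1)[OF that] in \<open>auto simp: less_top\<close>)
  qed
  \<comment> \<open>For almost every \<open>(x, y)\<close> both factors of the integrand are square-integrable in \<open>\<theta>\<close>.\<close>
  have pair_slice: "AE (x, y) in M1 \<Otimes>\<^sub>M M3. k x \<in> borel_measurable M2 \<and> K x < \<infinity> \<and>
      (\<lambda>\<theta>. F u \<theta> y) \<in> borel_measurable M2 \<and> N u y < \<infinity>" if "u \<in> V" for u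
    using AE_pair_fst[OF sf(1,3) k_slice] AE_pair_snd[OF sf(1,3) F_slice[OF that]]
    by eventually_elim auto
  show int: "AE (x, y) in M1 \<Otimes>\<^sub>M M3. integrable M2 (\<lambda>\<theta>. k x \<theta> * F u \<theta> y)" if "u \<in> V" for u
    using pair_slice[OF that]
    by eventually_elim (auto simp: K_def N_def intro: ennreal_square_integral_mult_le(2))
  show "L2_map V M1 M3 (\<lambda>u x y. \<integral>\<theta>. k x \<theta> * F u \<theta> y \<partial>M2)"
  proof (rule L2_mapI[where C = "enn2real (\<integral>\<^sup>+x. K x \<partial>M1) * C"])
    fix u assume u: "u \<in> V"
    have "(\<lambda>p. case_prod k (fst (fst p), snd p) * case_prod (F u) (snd p, snd (fst p)))
        \<in> borel_measurable ((M1 \<Otimes>\<^sub>M M3) \<Otimes>\<^sub>M M2)"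
      by (intro borel_measurable_times measurable_compose[OF _ km] measurable_compose[OF _ F(1)[OF u]])
        simp_all
    then show "(\<lambda>(x, y). \<integral>\<theta>. k x \<theta> * F u \<theta> y \<partial>M2) \<in> borel_measurable (M1 \<Otimes>\<^sub>M M3)"
      using M2.borel_measurable_lebesgue_integral[of
        "\<lambda>p \<theta>. k (fst p) \<theta> * F u \<theta> (snd p)" "M1 \<Otimes>\<^sub>M M3"]
      by (simp add: case_prod_unfold)
    \<comment> \<open>Cauchy-Schwarz in \<open>\<theta>\<close> separates the variables; the squared norm of \<open>k\<close> becomes the constant.\<close>
    have "(\<integral>\<^sup>+(x, y). ennreal ((\<integral>\<theta>. k x \<theta> * F u \<theta> y \<partial>M2)\<^sup>2) \<partial>(M1 \<Otimes>\<^sub>M M3)) \<le>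
        (\<integral>\<^sup>+(x, y). K x * N u y \<partial>(M1 \<Otimes>\<^sub>M M3))"
      by (rule nn_integral_mono_AE, use pair_slice[OF u] in eventually_elim)
        (auto simp: K_def N_def intro!: ennreal_square_integral_mult_le(1))
    also have "\<dots> = (\<integral>\<^sup>+x. \<integral>\<^sup>+y. K x * N u y \<partial>M3 \<partial>M1)"
      using M3.nn_integral_fst[of "\<lambda>(x, y). K x * N u y" M1] N_meas[OF u]
      by (simp add: case_prod_unfold)
    also have "\<dots> = (\<integral>\<^sup>+x. K x \<partial>M1) * (\<integral>\<^sup>+y. N u y \<partial>M3)"
      using N_meas[OF u] by (simp add: nn_integral_cmult nn_integral_multc)
    also have "\<dots> \<le> ennreal (enn2real (\<integral>\<^sup>+x. K x \<partial>M1)) * ennreal (C * (norm u)\<^sup>2)"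
      using kfin N_int[OF u] by (intro mult_mono) (auto simp: K_int)
    also have "\<dots> = ennreal (enn2real (\<integral>\<^sup>+x. K x \<partial>M1) * C * (norm u)\<^sup>2)"
      using F(3) by (simp add: ennreal_mult'[symmetric] mult.assoc)
    finally show "(\<integral>\<^sup>+(x, y). ennreal ((\<integral>\<theta>. k x \<theta> * F u \<theta> y \<partial>M2)\<^sup>2) \<partial>(M1 \<Otimes>\<^sub>M M3)) \<le>
        ennreal (enn2real (\<integral>\<^sup>+x. K x \<partial>M1) * C * (norm u)\<^sup>2)" .
  next
    fix u w r assume uw: "u \<in> V" "w \<in> V"
    then have s: "u + r *\<^sub>R w \<in> V" using V by (simp add: subspace_add subspace_scale)
    have "AE (y, \<theta>) in M3 \<Otimes>\<^sub>M M2. F (u + r *\<^sub>R w) \<theta> y = F u \<theta> y + r * F w \<theta> y"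
      by (rule AE_pair_swap[OF sf(2,3) F(2)[OF uw]])
    then have "AE y in M3. AE \<theta> in M2. F (u + r *\<^sub>R w) \<theta> y = F u \<theta> y + r * F w \<theta> y"
      using M32.AE_pair[of "\<lambda>(y, \<theta>). F (u + r *\<^sub>R w) \<theta> y = F u \<theta> y + r * F w \<theta> y"] by simp
    from AE_pair_snd[OF sf(1,3) this] pair_slice[OF s] pair_slice[OF uw(1)] pair_slice[OF uw(2)]
      int[OF uw(1)] int[OF uw(2)]
    show "AE (x, y) in M1 \<Otimes>\<^sub>M M3. (\<integral>\<theta>. k x \<theta> * F (u + r *\<^sub>R w) \<theta> y \<partial>M2) =
        (\<integral>\<theta>. k x \<theta> * F u \<theta> y \<partial>M2) + r * (\<integral>\<theta>. k x \<theta> * F w \<theta> y \<partial>M2)"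
    proof eventually_elim
      case (elim z)
      obtain x y where z: "z = (x, y)" by (cases z)
      have [measurable]: "k x \<in> borel_measurable M2" "(\<lambda>\<theta>. F u \<theta> y) \<in> borel_measurable M2"
        "(\<lambda>\<theta>. F w \<theta> y) \<in> borel_measurable M2"
        "(\<lambda>\<theta>. F (u + r *\<^sub>R w) \<theta> y) \<in> borel_measurable M2"
        using elim by (simp_all add: z)
      have "(\<integral>\<theta>. k x \<theta> * F (u + r *\<^sub>R w) \<theta> y \<partial>M2) =
          (\<integral>\<theta>. k x \<theta> * F u \<theta> y + r * (k x \<theta> * F w \<theta> y) \<partial>M2)"
        by (rule integral_cong_AE)
          (use elim in \<open>auto simp: z algebra_simps elim!: eventually_mono\<close>)
      also have "\<dots> = (\<integral>\<theta>. k x \<theta> * F u \<theta> y \<partial>M2) + r * (\<integral>\<theta>. k x \<theta> * F w \<theta> y \<partial>M2)"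
        using elim by (simp add: z)
      finally show ?case by (simp add: z)
    qed
  qed (use F(3) in auto)
qed

lemma L2_map_kernel_sum:
  fixes n :: nat
  assumes V: "subspace V"
    and sf: "sigma_finite_measure M1" "sigma_finite_measure M2" "sigma_finite_measure M3"
    and k: "\<And>j. j < n \<Longrightarrow> L2_kernel M1 M2 (k j)" and F: "\<And>j. j < n \<Longrightarrow> L2_map V M2 M3 (F j)"
  shows "L2_map V M1 M3 (\<lambda>u x y. \<integral>\<theta>. (\<Sum>j<n. k j x \<theta> * F j u \<theta> y) \<partial>M2)"
proof (rule L2_map_cong_AE[OF V])
  show "L2_map V M1 M3 (\<lambda>u x y. \<Sum>j<n. \<integral>\<theta>. k j x \<theta> * F j u \<theta> y \<partial>M2)"
    using k F by (intro L2_map_sum L2_map_kernel(1)[OF V sf]) auto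
  interpret M2: sigma_finite_measure M2 by fact
  fix u assume u: "u \<in> V"
  have m: "(\<lambda>p. case_prod (k j) (fst (fst p), snd p) * case_prod (F j u) (snd p, snd (fst p)))
        \<in> borel_measurable ((M1 \<Otimes>\<^sub>M M3) \<Otimes>\<^sub>M M2)" if "j < n" for j
  proof (intro borel_measurable_times)
    show "(\<lambda>p. case_prod (k j) (fst (fst p), snd p)) \<in> borel_measurable ((M1 \<Otimes>\<^sub>M M3) \<Otimes>\<^sub>M M2)"
      by (rule measurable_compose[where g = "case_prod (k j)" and N = "M1 \<Otimes>\<^sub>M M2"])
        (use k[OF that] in \<open>auto simp: L2_kernel_def\<close>)
    show "(\<lambda>p. case_prod (F j u) (snd p, snd (fst p))) \<in> borel_measurable ((M1 \<Otimes>\<^sub>M M3) \<Otimes>\<^sub>M M2)"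
      by (rule measurable_compose[where g = "case_prod (F j u)" and N = "M2 \<Otimes>\<^sub>M M3"])
        (use L2_map_measurable[OF F[OF that] u] in auto)
  qed
  show "(\<lambda>(x, y). \<integral>\<theta>. (\<Sum>j<n. k j x \<theta> * F j u \<theta> y) \<partial>M2) \<in> borel_measurable (M1 \<Otimes>\<^sub>M M3)"
    using M2.borel_measurable_lebesgue_integral[of
      "\<lambda>p \<theta>. \<Sum>j<n. k j (fst p) \<theta> * F j u \<theta> (snd p)" "M1 \<Otimes>\<^sub>M M3"] m
    by (simp add: case_prod_unfold)
  have "AE z in M1 \<Otimes>\<^sub>M M3. \<forall>j\<in>{..<n}. case z of (x, y) \<Rightarrow> integrable M2 (\<lambda>\<theta>. k j x \<theta> * F j u \<theta> y)"
    using k F u by (intro AE_finite_allI L2_map_kernel(2)[OF V sf]) auto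
  then show "AE (x, y) in M1 \<Otimes>\<^sub>M M3. (\<integral>\<theta>. (\<Sum>j<n. k j x \<theta> * F j u \<theta> y) \<partial>M2) =
      (\<Sum>j<n. \<integral>\<theta>. k j x \<theta> * F j u \<theta> y \<partial>M2)"
    by eventually_elim (auto simp: case_prod_unfold)
qed

lemma L2_map_kernel_right:
  assumes V: "subspace V"
    and sf: "sigma_finite_measure M1" "sigma_finite_measure M2" "sigma_finite_measure M3"
    and k: "L2_kernel M3 M2 k" and F: "L2_map V M1 M2 F"
  shows "L2_map V M1 M3 (\<lambda>u x y. \<integral>\<nu>. k y \<nu> * F u x \<nu> \<partial>M2)"
  by (rule L2_map_swap[OF sf(3,1)
      L2_map_kernel(1)[OF V sf(3,2,1) k L2_map_swap[OF sf(1,2) F]]])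


section \<open>The one-point space\<close>

text \<open>
  A missing variable is modelled by a one-point space. A vector of numbers, a function of \<open>x\<close>, a
  function of \<open>y\<close> and a function of both then all have values in \<open>L2 (M \<Otimes> N)\<close> for suitable \<open>M\<close> and
  \<open>N\<close>, and multiplication by an \<open>L2\<close> function and integration against one are both kernel operators.
\<close>

abbreviation pt :: "unit measure" where "pt \<equiv> count_space UNIV"

lemma sigma_finite_pt: "sigma_finite_measure pt"
  by (rule sigma_finite_measure_count_space_finite) simp

lemma pt_pair_measurable: "case_prod f \<in> borel_measurable (M \<Otimes>\<^sub>M pt) \<longleftrightarrow> (\<lambda>x. f x ()) \<in> borel_measurable M"
proof
  assume *: "case_prod f \<in> borel_measurable (M \<Otimes>\<^sub>M pt)"
  have "(\<lambda>x. (x, ())) \<in> M \<rightarrow>\<^sub>M M \<Otimes>\<^sub>M pt" by simp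
  from measurable_compose[OF this *] show "(\<lambda>x. f x ()) \<in> borel_measurable M" by simp
next
  assume *: "(\<lambda>x. f x ()) \<in> borel_measurable M"
  have "case_prod f = (\<lambda>x. f x ()) \<circ> fst" by (auto simp: fun_eq_iff)
  then show "case_prod f \<in> borel_measurable (M \<Otimes>\<^sub>M pt)"
    using * by (auto intro: measurable_comp)
qed

lemma nn_integral_pt: "(\<integral>\<^sup>+u. f u \<partial>pt) = f ()"
  by (simp add: nn_integral_count_space_finite UNIV_unit)

lemma nn_integral_pair_pt:
  assumes "case_prod f \<in> borel_measurable (M \<Otimes>\<^sub>M pt)"
  shows "(\<integral>\<^sup>+(x, u). f x u \<partial>(M \<Otimes>\<^sub>M pt)) = (\<integral>\<^sup>+x. f x () \<partial>M)"
  using sigma_finite_measure.nn_integral_fst[OF sigma_finite_pt assms] by (simp add: nn_integral_pt)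

lemma AE_pair_pt:
  assumes "sigma_finite_measure M" "AE (x, u) in M \<Otimes>\<^sub>M pt. P x u"
  shows "AE x in M. P x ()"
proof -
  interpret pair_sigma_finite M pt
    using assms(1) sigma_finite_pt by (simp add: pair_sigma_finite_def)
  show ?thesis
    using AE_pair[OF assms(2)] by (auto simp: AE_count_space elim!: eventually_mono)
qed

lemma sigma_finite_lborel: "sigma_finite_measure lborel"
  by (rule lborel.sigma_finite_measure_axioms)

lemma L2_kernel_swap:
  assumes "sigma_finite_measure M" "sigma_finite_measure N" "L2_kernel M N k"
  shows "L2_kernel N M (\<lambda>y x. k x y)"
proof -
  have m: "case_prod k \<in> borel_measurable (M \<Otimes>\<^sub>M N)" using assms(3) by (simp add: L2_kernel_def)
  have "(\<lambda>(x, y). ennreal ((k x y)\<^sup>2)) \<in> borel_measurable (M \<Otimes>\<^sub>M N)"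
    using m by (auto simp: case_prod_unfold)
  from nn_integral_pair_swap[OF assms(1,2) this] show ?thesis
    using assms(3) measurable_pair_swap[OF m] by (simp add: L2_kernel_def)
qed

lemma L2_kernel_pt:
  assumes "f \<in> borel_measurable M" "(\<integral>\<^sup>+x. ennreal ((f x)\<^sup>2) \<partial>M) < \<infinity>"
  shows "L2_kernel M pt (\<lambda>x _. f x)"
  using assms nn_integral_pair_pt[of "\<lambda>x _. ennreal ((f x)\<^sup>2)" M]
  by (simp add: L2_kernel_def pt_pair_measurable)

lemma integral_pt: "(\<integral>u. f u \<partial>pt) = (f () :: real)"
  by (subst lebesgue_integral_count_space_finite) (auto simp: UNIV_unit)

text \<open>
  The kernel operator whose inner variable ranges over one point: a tensor product with a fixed
  \<open>L2\<close> function.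
\<close>

lemma L2_map_pt_left:
  assumes V: "subspace V" and sf: "sigma_finite_measure M1" "sigma_finite_measure M3"
    and f: "f \<in> borel_measurable M1" "(\<integral>\<^sup>+x. ennreal ((f x)\<^sup>2) \<partial>M1) < \<infinity>" and F: "L2_map V pt M3 F"
  shows "L2_map V M1 M3 (\<lambda>u x y. f x * F u () y)"
  using L2_map_kernel(1)[OF V sf(1) sigma_finite_pt sf(2) L2_kernel_pt[OF f] F]
  by (simp add: integral_pt)


section \<open>Bounded linear operators on a subspace\<close>

text \<open>
  PI operators are constrained only on the subspace \<open>Z\<close> of their arguments and are arbitrary elsewhere,
  so linearity and boundedness are relative to a subspace.
\<close>

definition bounded_linear_on :: "'v::real_normed_vector set \<Rightarrow> ('v \<Rightarrow> 'w::real_normed_vector) \<Rightarrow> bool" where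
  "bounded_linear_on V f \<longleftrightarrow>
     (\<forall>u\<in>V. \<forall>w\<in>V. \<forall>r. f (u + r *\<^sub>R w) = f u + r *\<^sub>R f w) \<and> (\<exists>C. \<forall>u\<in>V. norm (f u) \<le> C * norm u)"

lemma bounded_linear_on_Pair:
  assumes "bounded_linear_on V f" "bounded_linear_on V g"
  shows "bounded_linear_on V (\<lambda>u. (f u, g u))"
proof -
  from assms obtain C D where *: "\<forall>u\<in>V. norm (f u) \<le> C * norm u" "\<forall>u\<in>V. norm (g u) \<le> D * norm u"
    unfolding bounded_linear_on_def by blast
  have "norm (f u, g u) \<le> (C + D) * norm u" if "u \<in> V" for u
    using * that norm_Pair_le[of "f u" "g u"] by (fastforce simp: algebra_simps)
  with assms show ?thesis unfolding bounded_linear_on_def by auto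
qed

lemma norm_poly_mapping_le_sum:
  fixes f :: "'a \<Rightarrow>\<^sub>0 'b::real_inner"
  assumes "finite I" "keys f \<subseteq> I"
  shows "norm f \<le> (\<Sum>i\<in>I. norm (lookup f i))"
proof -
  have "norm f = L2_set (\<lambda>i. norm (lookup f i)) I"
    by (simp add: norm_eq_sqrt_inner[of f] inner_poly_mapping_superset[OF assms] L2_set_def
        power2_norm_eq_inner)
  also have "\<dots> \<le> (\<Sum>i\<in>I. norm (lookup f i))"
    by (rule L2_set_le_sum) simp
  finally show ?thesis .
qed

lemma norm_lookup_le: "norm (lookup f i) \<le> norm (f :: 'a \<Rightarrow>\<^sub>0 'b::real_inner)"
proof -
  have "norm (lookup f i) \<le> L2_set (\<lambda>i. norm (lookup f i)) (insert i (keys f))"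
    by (rule member_le_L2_set) auto
  also have "\<dots> = norm f"
    by (subst norm_eq_sqrt_inner, subst inner_poly_mapping_superset[of "insert i (keys f)"])
      (auto simp: L2_set_def power2_norm_eq_inner)
  finally show ?thesis .
qed

lemma bounded_linear_lookup: "bounded_linear (\<lambda>f :: 'a \<Rightarrow>\<^sub>0 'b::real_inner. lookup f i)"
  by (rule bounded_linear_intro[where K = 1])
    (simp_all add: lookup_add scaleR_poly_mapping.rep_eq norm_lookup_le)

lemma bounded_linear_on_poly_mapping:
  fixes f :: "'v::real_normed_vector \<Rightarrow> 'a \<Rightarrow>\<^sub>0 'b::real_inner"
  assumes V: "subspace V" and I: "finite I" "\<And>u. u \<in> V \<Longrightarrow> keys (f u) \<subseteq> I"
    and f: "\<And>i. i \<in> I \<Longrightarrow> bounded_linear_on V (\<lambda>u. lookup (f u) i)"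
  shows "bounded_linear_on V f"
  unfolding bounded_linear_on_def
proof (intro conjI ballI allI)
  fix u w r assume uw: "u \<in> V" "w \<in> V"
  then have s: "u + r *\<^sub>R w \<in> V" using V by (simp add: subspace_add subspace_scale)
  show "f (u + r *\<^sub>R w) = f u + r *\<^sub>R f w"
  proof (rule poly_mapping_eqI)
    fix i
    show "lookup (f (u + r *\<^sub>R w)) i = lookup (f u + r *\<^sub>R f w) i"
    proof (cases "i \<in> I")
      case True
      then show ?thesis using f[OF True] uw
        by (simp add: bounded_linear_on_def lookup_add scaleR_poly_mapping.rep_eq)
    next
      case False
      then have "lookup (f u) i = 0" "lookup (f w) i = 0" "lookup (f (u + r *\<^sub>R w)) i = 0"
        using I(2)[OF uw(1)] I(2)[OF uw(2)] I(2)[OF s] by (auto simp: in_keys_iff)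
      then show ?thesis by (simp add: lookup_add scaleR_poly_mapping.rep_eq)
    qed
  qed
next
  have "\<forall>i\<in>I. \<exists>C. \<forall>u\<in>V. norm (lookup (f u) i) \<le> C * norm u"
    using f unfolding bounded_linear_on_def by blast
  then obtain C where C: "\<forall>i\<in>I. \<forall>u\<in>V. norm (lookup (f u) i) \<le> C i * norm u" by metis
  have "norm (f u) \<le> (\<Sum>i\<in>I. C i) * norm u" if "u \<in> V" for u
  proof -
    have "norm (f u) \<le> (\<Sum>i\<in>I. norm (lookup (f u) i))"
      by (rule norm_poly_mapping_le_sum[OF I(1) I(2)[OF that]])
    also have "\<dots> \<le> (\<Sum>i\<in>I. C i * norm u)" using C that by (intro sum_mono) auto
    finally show ?thesis by (simp add: sum_distrib_right)
  qed
  then show "\<exists>C. \<forall>u\<in>V. norm (f u) \<le> C * norm u" by blast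
qed


section \<open>The subspaces \<open>Z\<close> are closed\<close>

lemma rep_lsq_sq_integrable: "sq_integrable (rep_lsq u)"
  using Quotient_rep_reflp[OF Quotient_lsq, of u] by (simp add: lsq_rel_def)

text \<open>
  The interface to the quotient: classes are equal exactly if representatives agree almost everywhere.
  Together with the pointwise rules below, it replaces transfer, which does not see individual
  representatives.
\<close>

lemma abs_lsq_eq_iff: "sq_integrable f \<Longrightarrow> abs_lsq f = u \<longleftrightarrow> (AE x in lborel. f x = rep_lsq u x)"
  using Quotient_rel_abs2[OF Quotient_lsq] Quotient_rel[OF Quotient_lsq, of f "rep_lsq u"]
  by (simp add: lsq_rel_def rep_lsq_sq_integrable Quotient_abs_rep[OF Quotient_lsq])

lemma lsq_eqI: "AE x in lborel. rep_lsq u x = rep_lsq w x \<Longrightarrow> u = w"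
  using abs_lsq_eq_iff[OF rep_lsq_sq_integrable, of u w] Quotient_abs_rep[OF Quotient_lsq, of u]
  by simp

lemma rep_abs_lsq: "sq_integrable f \<Longrightarrow> AE x in lborel. rep_lsq (abs_lsq f) x = f x"
  using abs_lsq_eq_iff[of f "abs_lsq f"] by (auto elim: eventually_mono)

lemma rep_lsq_zero: "AE x in lborel. rep_lsq (0::'a::euclidean_space lsq) x = 0"
  unfolding zero_lsq_def by (rule rep_abs_lsq[OF sq_integrable_zero])

lemma rep_lsq_add: "AE x in lborel. rep_lsq (u + w) x = rep_lsq u x + rep_lsq w x"
  unfolding plus_lsq_def map_fun_def comp_def id_def
  by (rule rep_abs_lsq) (intro sq_integrable_add rep_lsq_sq_integrable)

lemma rep_lsq_scaleR: "AE x in lborel. rep_lsq (r *\<^sub>R u) x = r * rep_lsq u x"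
  unfolding scaleR_lsq_def map_fun_def comp_def id_def
  by (rule rep_abs_lsq) (intro sq_integrable_scale rep_lsq_sq_integrable)

lemma inner_lsq_rep: "inner u w = (LINT x|lborel. rep_lsq u x * rep_lsq w x)"
  unfolding inner_lsq_def by (simp add: map_fun_def)

lemma rep_lsq_measurable [measurable]: "rep_lsq u \<in> borel_measurable borel"
  using rep_lsq_sq_integrable[of u] by (simp add: sq_integrable_def)

lemma nn_integral_rep_lsq: "(\<integral>\<^sup>+x. ennreal ((rep_lsq u x)\<^sup>2) \<partial>lborel) = ennreal ((norm u)\<^sup>2)"
proof -
  have "(\<integral>\<^sup>+x. ennreal ((rep_lsq u x)\<^sup>2) \<partial>lborel) = ennreal (LINT x|lborel. (rep_lsq u x)\<^sup>2)"
    using rep_lsq_sq_integrable[of u]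
    by (intro nn_integral_eq_integral) (auto simp: sq_integrable_def)
  also have "(LINT x|lborel. (rep_lsq u x)\<^sup>2) = (norm u)\<^sup>2"
    unfolding power2_norm_eq_inner inner_lsq_rep by (simp add: power2_eq_square)
  finally show ?thesis .
qed

lemma subspace_lsq_on: "subspace (lsq_on S)"
  unfolding subspace_def lsq_on_def
proof (intro conjI allI ballI)
  show "0 \<in> {u. AE x in lborel. x \<notin> S \<longrightarrow> rep_lsq u x = 0}"
    using rep_lsq_zero by (auto elim: eventually_mono)
  fix u assume u: "u \<in> {u. AE x in lborel. x \<notin> S \<longrightarrow> rep_lsq u x = 0}"
  show "r *\<^sub>R u \<in> {u. AE x in lborel. x \<notin> S \<longrightarrow> rep_lsq u x = 0}" for r
    using u rep_lsq_scaleR[of r u] by (auto elim!: eventually_elim2)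
  fix w assume w: "w \<in> {u. AE x in lborel. x \<notin> S \<longrightarrow> rep_lsq u x = 0}"
  have "AE x in lborel. x \<notin> S \<longrightarrow> rep_lsq u x = 0" "AE x in lborel. x \<notin> S \<longrightarrow> rep_lsq w x = 0"
    using u w by auto
  with rep_lsq_add[of u w] have "AE x in lborel. x \<notin> S \<longrightarrow> rep_lsq (u + w) x = 0"
    by eventually_elim auto
  then show "u + w \<in> {u. AE x in lborel. x \<notin> S \<longrightarrow> rep_lsq u x = 0}" by simp
qed

text \<open>
  Functions vanishing off \<open>S\<close> are the orthogonal complement of those vanishing on \<open>S\<close>. This is what
  makes \<open>lsq_on S\<close> closed.
\<close>

lemma lsq_on_eq_orthogonal:
  assumes S: "S \<in> sets borel"
  shows "lsq_on S = (\<Inter>w\<in>lsq_on (- S). {u. inner u w = 0})"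
proof (intro set_eqI iffI)
  fix u assume u: "u \<in> lsq_on S"
  have "inner u w = 0" if "w \<in> lsq_on (- S)" for w
  proof -
    have "AE x in lborel. x \<notin> S \<longrightarrow> rep_lsq u x = 0" "AE x in lborel. x \<in> S \<longrightarrow> rep_lsq w x = 0"
      using u that by (auto simp: lsq_on_def)
    then have "AE x in lborel. rep_lsq u x * rep_lsq w x = 0"
      by eventually_elim auto
    then show ?thesis by (simp add: inner_lsq_rep integral_eq_zero_AE)
  qed
  then show "u \<in> (\<Inter>w\<in>lsq_on (- S). {u. inner u w = 0})" by auto
next
  fix u assume u: "u \<in> (\<Inter>w\<in>lsq_on (- S). {u. inner u w = 0})"
  \<comment> \<open>Test \<open>u\<close> against its own restriction to the complement of \<open>S\<close>.\<close>
  define f where "f x = indicat_real (- S) x * rep_lsq u x" for x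
  have [measurable]: "S \<in> sets borel" by fact
  have int: "integrable lborel (\<lambda>x. (rep_lsq u x)\<^sup>2)"
    using rep_lsq_sq_integrable[of u] by (simp add: sq_integrable_def)
  have sq: "(f x)\<^sup>2 = indicat_real (- S) x * (rep_lsq u x)\<^sup>2" for x
    by (simp add: f_def indicator_def)
  have fm: "f \<in> borel_measurable borel" unfolding f_def by measurable
  have f2: "integrable lborel (\<lambda>x. (f x)\<^sup>2)"
    using fm by (intro Bochner_Integration.integrable_bound[OF int])
      (auto simp: sq indicator_def)
  have f: "sq_integrable f"
    using fm f2 by (simp add: sq_integrable_def)
  have w: "AE x in lborel. rep_lsq (abs_lsq f) x = f x" by (rule rep_abs_lsq[OF f])
  then have "abs_lsq f \<in> lsq_on (- S)"
    by (auto simp: lsq_on_def f_def indicator_def elim!: eventually_mono split: if_splits)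
  then have "(LINT x|lborel. rep_lsq u x * rep_lsq (abs_lsq f) x) = 0"
    using u by (simp add: inner_lsq_rep)
  also have "(LINT x|lborel. rep_lsq u x * rep_lsq (abs_lsq f) x) = (LINT x|lborel. (f x)\<^sup>2)"
    by (rule integral_cong_AE)
      (use w fm in \<open>auto elim!: eventually_mono simp: sq power2_eq_square f_def indicator_def\<close>)
  finally have "AE x in lborel. (f x)\<^sup>2 = 0"
    using integral_nonneg_eq_0_iff_AE[OF f2] by simp
  then show "u \<in> lsq_on S"
    by (auto simp: lsq_on_def f_def indicator_def elim!: eventually_mono)
qed

lemma closed_lsq_on: "S \<in> sets borel \<Longrightarrow> closed (lsq_on S)"
  by (subst lsq_on_eq_orthogonal) (auto intro!: closed_INT closed_Collect_eq continuous_intros)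

lemma vecs_eq: "vecs n X = {u. (\<forall>i<n. lookup u i \<in> X) \<and> (\<forall>i\<ge>n. lookup u i = 0)}"
proof -
  have "keys u \<subseteq> {..<n} \<longleftrightarrow> (\<forall>i\<ge>n. lookup u i = 0)" for u :: "nat \<Rightarrow>\<^sub>0 'a"
    unfolding subset_eq Ball_def in_keys_iff lessThan_iff by (metis leD leI)
  then show ?thesis by (auto simp: vecs_def)
qed

lemma subspace_vecs: "subspace X \<Longrightarrow> subspace (vecs n X)"
  unfolding vecs_eq subspace_def by (auto simp: lookup_add scaleR_poly_mapping.rep_eq)

text \<open>Membership in \<open>vecs n X\<close> is a condition on each entry, and taking an entry is continuous.\<close>

lemma closed_vecs: 
  fixes X :: "'b::real_inner set"
  assumes "closed X" shows "closed (vecs n X)"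
proof -
  have "u \<in> vecs n X \<longleftrightarrow> (\<forall>i. lookup u i \<in> (if i < n then X else {0}))" for u
    unfolding vecs_eq mem_Collect_eq by (metis leD leI singleton_iff)
  then have "vecs n X = (\<Inter>i. (\<lambda>u. lookup u i) -` (if i < n then X else {0}))"
    by blast
  moreover have "closed ((\<lambda>u :: nat \<Rightarrow>\<^sub>0 'b. lookup u i) -` (if i < n then X else {0}))" for i
    using assms by (intro continuous_closed_vimage)
      (auto intro: linear_continuous_at bounded_linear_lookup)
  ultimately show ?thesis by (simp add: closed_INT)
qed

lemma subspace_Z: "subspace (Z a b c d n)"
  by (cases n) (auto simp: Z_def intro!: subspace_Times subspace_vecs subspace_lsq_on subspace_UNIV)

lemma closed_Z: "closed (Z a b c d n)"
  by (cases n) (auto simp: Z_def intro!: closed_Times closed_vecs closed_lsq_on borel_closed)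


section \<open>Differentiation along a closed subspace\<close>

text \<open>Without this, applying a PI operator to the time derivative of a state would be meaningless.\<close>

lemma has_vector_derivative_in_closed_subspace:
  assumes V: "subspace V" "closed V" and S: "t \<in> S" "at t within S \<noteq> bot"
    and v: "\<And>s. s \<in> S \<Longrightarrow> v s \<in> V" and d: "(v has_vector_derivative v') (at t within S)"
  shows "v' \<in> V"
proof (rule Lim_in_closed_set[OF V(2) _ S(2)])
  \<comment> \<open>Difference quotients of \<open>v\<close> lie in \<open>V\<close> and converge to \<open>v'\<close>.\<close>
  let ?q = "\<lambda>s. (1 / (s - t)) *\<^sub>R (v s - v t)"
  have "((\<lambda>s. norm (v s - v t - (s - t) *\<^sub>R v') / norm (s - t)) \<longlongrightarrow> 0) (at t within S)"
    using d by (simp add: has_vector_derivative_def has_derivative_iff_norm)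
  moreover have "\<forall>\<^sub>F s in at t within S.
      norm (v s - v t - (s - t) *\<^sub>R v') / norm (s - t) = norm (?q s - v')"
    unfolding eventually_at_filter
  proof (intro always_eventually allI impI)
    fix s assume "s \<noteq> t"
    then have "?q s - v' = (1 / (s - t)) *\<^sub>R (v s - v t - (s - t) *\<^sub>R v')"
      by (simp add: scaleR_diff_right)
    then show "norm (v s - v t - (s - t) *\<^sub>R v') / norm (s - t) = norm (?q s - v')"
      by (simp add: divide_inverse mult.commute)
  qed
  ultimately have "((\<lambda>s. norm (?q s - v')) \<longlongrightarrow> 0) (at t within S)"
    by (rule Lim_transform_eventually)
  then show "(?q \<longlongrightarrow> v') (at t within S)"
    by (simp add: tendsto_norm_zero_iff LIM_zero_iff)
  show "\<forall>\<^sub>F s in at t within S. (1 / (s - t)) *\<^sub>R (v s - v t) \<in> V"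
    unfolding eventually_at_filter
    by (auto intro!: always_eventually subspace_scale subspace_diff V v S)
qed

text \<open>
  The chain rule for an operator that is linear and bounded only on a closed subspace containing the
  curve. The derivative stays in the subspace, so the error of the linear approximation of \<open>f \<circ> v\<close> is
  the image under \<open>f\<close> of the error for \<open>v\<close>.
\<close>

lemma bounded_linear_on_has_vector_derivative:
  assumes V: "subspace V" "closed V" and S: "t \<in> S" "at t within S \<noteq> bot"
    and f: "bounded_linear_on V f"
    and v: "\<And>s. s \<in> S \<Longrightarrow> v s \<in> V" and d: "(v has_vector_derivative v') (at t within S)"
  shows "((\<lambda>s. f (v s)) has_vector_derivative f v') (at t within S)"
proof -
  have v': "v' \<in> V" by (rule has_vector_derivative_in_closed_subspace[OF V S v d])
  from f obtain C where lin: "\<And>u w r. u \<in> V \<Longrightarrow> w \<in> V \<Longrightarrow> f (u + r *\<^sub>R w) = f u + r *\<^sub>R f w"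
    and C: "\<And>u. u \<in> V \<Longrightarrow> norm (f u) \<le> C * norm u"
    unfolding bounded_linear_on_def by blast
  have lim: "((\<lambda>s. norm (v s - v t - (s - t) *\<^sub>R v') / norm (s - t)) \<longlongrightarrow> 0) (at t within S)"
    using d by (simp add: has_vector_derivative_def has_derivative_iff_norm)
  have "((\<lambda>s. norm (f (v s) - f (v t) - (s - t) *\<^sub>R f v') / norm (s - t)) \<longlongrightarrow> 0) (at t within S)"
  proof (rule tendsto_sandwich[OF _ _ tendsto_const])
    show "((\<lambda>s. C * (norm (v s - v t - (s - t) *\<^sub>R v') / norm (s - t))) \<longlongrightarrow> 0) (at t within S)"
      using tendsto_mult_left[OF lim, of C] by simp
    show "\<forall>\<^sub>F s in at t within S. norm (f (v s) - f (v t) - (s - t) *\<^sub>R f v') / norm (s - t) \<le>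
        C * (norm (v s - v t - (s - t) *\<^sub>R v') / norm (s - t))"
      unfolding eventually_at_filter
    proof (intro always_eventually allI impI)
      fix s assume s: "s \<in> S"
      have d: "v s + (- 1) *\<^sub>R v t \<in> V"
        using v[OF s] v[OF S(1)] V(1) by (intro subspace_add subspace_scale)
      \<comment> \<open>Written with \<open>+\<close> and scalars, so that linearity of \<open>f\<close> on \<open>V\<close> applies twice.\<close>
      have e: "v s - v t - (s - t) *\<^sub>R v' = (v s + (- 1) *\<^sub>R v t) + (t - s) *\<^sub>R v'"
        by (simp add: algebra_simps)
      have "f (v s - v t - (s - t) *\<^sub>R v') = f (v s) - f (v t) - (s - t) *\<^sub>R f v'"
        unfolding e lin[OF d v'] lin[OF v[OF s] v[OF S(1)]] by (simp add: algebra_simps)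
      moreover have "v s - v t - (s - t) *\<^sub>R v' \<in> V"
        unfolding e by (rule subspace_add[OF V(1) d subspace_scale[OF V(1) v']])
      ultimately have "norm (f (v s) - f (v t) - (s - t) *\<^sub>R f v') \<le> C * norm (v s - v t - (s - t) *\<^sub>R v')"
        using C by metis
      then show "norm (f (v s) - f (v t) - (s - t) *\<^sub>R f v') / norm (s - t) \<le>
        C * (norm (v s - v t - (s - t) *\<^sub>R v') / norm (s - t))"
        by (simp add: divide_right_mono)
    qed
  qed auto
  then show ?thesis
    by (simp add: has_vector_derivative_def has_derivative_iff_norm bounded_linear_scaleR_left)
qed


section \<open>Joining and splitting states\<close>

lemma lookup_vec: 
  "lookup (vec_append k u w) i = (if i < k then lookup u i else lookup w (i - k))"
  "lookup (vec_take k u) i = (if i < k then lookup u i else 0)"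
  "lookup (vec_drop k u) i = lookup u (k + i)"
  by (simp_all add: vec_append.rep_eq vec_take.rep_eq vec_drop.rep_eq)

text \<open>
  If the entries of \<open>f\<close> occur among those of \<open>g\<close> at distinct positions, \<open>f\<close> is no longer than \<open>g\<close>.
  Truncations and shifts are of this kind.
\<close>

lemma norm_poly_mapping_le_if_inj:
  fixes f :: "'a \<Rightarrow>\<^sub>0 'b::real_inner" and g :: "'c \<Rightarrow>\<^sub>0 'b"
  assumes "inj_on h (keys f)" "\<And>i. i \<in> keys f \<Longrightarrow> lookup f i = lookup g (h i)"
  shows "norm f \<le> norm g"
proof -
  have "inner f f = (\<Sum>i\<in>h ` keys f. inner (lookup g i) (lookup g i))"
    using assms by (simp add: inner_poly_mapping_def sum.reindex)
  also have "\<dots> \<le> (\<Sum>i\<in>keys g. inner (lookup g i) (lookup g i))"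
    by (rule sum_mono2) (use assms(2) in \<open>auto simp: in_keys_iff\<close>)
  finally show ?thesis
    by (simp add: norm_eq_sqrt_inner inner_poly_mapping_def)
qed

lemma bounded_linear_vec_take: "bounded_linear (vec_take k :: (nat \<Rightarrow>\<^sub>0 'b::real_inner) \<Rightarrow> _)"
  by (rule bounded_linear_intro[where K = 1])
    (auto intro!: poly_mapping_eqI norm_poly_mapping_le_if_inj[where h = "\<lambda>i. i"]
      simp: lookup_vec lookup_add scaleR_poly_mapping.rep_eq in_keys_iff split: if_splits)

lemma bounded_linear_vec_drop: "bounded_linear (vec_drop k :: (nat \<Rightarrow>\<^sub>0 'b::real_inner) \<Rightarrow> _)"
  by (rule bounded_linear_intro[where K = 1])
    (auto intro!: poly_mapping_eqI norm_poly_mapping_le_if_inj[where h = "\<lambda>i. k + i"]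
      simp: lookup_vec lookup_add scaleR_poly_mapping.rep_eq)

lemma bounded_linear_vec_append:
  "bounded_linear (\<lambda>p :: (nat \<Rightarrow>\<^sub>0 'b::real_inner) \<times> (nat \<Rightarrow>\<^sub>0 'b). vec_append k (fst p) (snd p))"
proof (rule bounded_linear_intro[where K = 2])
  fix p :: "(nat \<Rightarrow>\<^sub>0 'b) \<times> (nat \<Rightarrow>\<^sub>0 'b)"
  \<comment> \<open>Each summand is a truncation or a shift, hence no longer than its argument.\<close>
  have "vec_append k (fst p) (snd p) = vec_append k (fst p) 0 + vec_append k 0 (snd p)"
    by (rule poly_mapping_eqI) (simp add: lookup_vec lookup_add)
  moreover have "norm (vec_append k (fst p) 0) \<le> norm (fst p)"
    by (rule norm_poly_mapping_le_if_inj[where h = "\<lambda>i. i"])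
      (auto simp: lookup_vec in_keys_iff split: if_splits)
  moreover have "norm (vec_append k 0 (snd p)) \<le> norm (snd p)"
    by (rule norm_poly_mapping_le_if_inj[where h = "\<lambda>i. i - k"])
      (auto simp: lookup_vec in_keys_iff inj_on_def split: if_splits)
  moreover have "norm (fst p) \<le> norm p" "norm (snd p) \<le> norm p"
    using norm_fst_le[of "fst p" "snd p"] norm_snd_le[of "snd p" "fst p"] by simp_all
  ultimately show "norm (vec_append k (fst p) (snd p)) \<le> norm p * 2"
    using norm_triangle_ineq[of "vec_append k (fst p) 0" "vec_append k 0 (snd p)"] by simp
qed (auto intro!: poly_mapping_eqI simp: lookup_vec lookup_add scaleR_poly_mapping.rep_eq)

lemma vec_take_append: "u \<in> vecs k X \<Longrightarrow> vec_take k (vec_append k u w) = u"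
  by (rule poly_mapping_eqI) (auto simp: lookup_vec vecs_eq)

lemma vec_drop_append: "vec_drop k (vec_append k u w) = w"
  by (rule poly_mapping_eqI) (auto simp: lookup_vec)

lemma vec_append_in_vecs: "u \<in> vecs k X \<Longrightarrow> w \<in> vecs l X \<Longrightarrow> vec_append k u w \<in> vecs (k + l) X"
  by (auto simp: vecs_eq lookup_vec split: if_splits)

lemma z_fst_join: "u \<in> Z a b c d n \<Longrightarrow> z_fst n (z_join n u w) = u"
  by (auto simp: z_fst_def z_join_def Z_def vec_take_append split: prod.splits)

lemma z_snd_join: "z_snd n (z_join n u w) = w"
  by (auto simp: z_snd_def z_join_def vec_drop_append split: prod.splits)

lemma z_join_in_Z: "u \<in> Z a b c d n \<Longrightarrow> w \<in> Z a b c d m \<Longrightarrow> z_join n u w \<in> Z a b c d (n + m)"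
  by (auto simp: z_join_def Z_def vec_append_in_vecs plus_prod_def split: prod.splits)

text \<open>Equations between joined states can be read componentwise.\<close>

lemma z_join_inject:
  assumes "u \<in> Z a b c d n" "u' \<in> Z a b c d n"
  shows "z_join n u w = z_join n u' w' \<longleftrightarrow> u = u' \<and> w = w'"
  by (metis assms z_fst_join z_snd_join)

lemma bounded_linear_z_fst: "bounded_linear (z_fst n)"
proof -
  obtain k0 k1 k2 k3 where n: "n = (k0, k1, k2, k3)" by (cases n)
  have "z_fst n = (\<lambda>u. (vec_take k0 (fst u), vec_take k1 (fst (snd u)), vec_take k2 (fst (snd (snd u))),
      vec_take k3 (snd (snd (snd u)))))"
    by (auto simp: n z_fst_def)
  then show ?thesis
    by (simp add: bounded_linear_Pair bounded_linear_compose[OF bounded_linear_vec_take]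
        bounded_linear_fst_comp bounded_linear_snd_comp bounded_linear_fst bounded_linear_snd)
qed

lemma bounded_linear_z_snd: "bounded_linear (z_snd n)"
proof -
  obtain k0 k1 k2 k3 where n: "n = (k0, k1, k2, k3)" by (cases n)
  have "z_snd n = (\<lambda>u. (vec_drop k0 (fst u), vec_drop k1 (fst (snd u)), vec_drop k2 (fst (snd (snd u))),
      vec_drop k3 (snd (snd (snd u)))))"
    by (auto simp: n z_snd_def)
  then show ?thesis
    by (simp add: bounded_linear_Pair bounded_linear_compose[OF bounded_linear_vec_drop]
        bounded_linear_fst_comp bounded_linear_snd_comp bounded_linear_fst bounded_linear_snd)
qed

lemma bounded_linear_z_join: "bounded_linear (\<lambda>p. z_join n (fst p) (snd p))"
proof -
  obtain k0 k1 k2 k3 where n: "n = (k0, k1, k2, k3)" by (cases n)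
  have *: "bounded_linear (\<lambda>p. vec_append k (f (fst p)) (f (snd p)))"
    if "bounded_linear f" for f :: "zspace \<Rightarrow> nat \<Rightarrow>\<^sub>0 'c::real_inner" and k
    using bounded_linear_compose[OF bounded_linear_vec_append
      bounded_linear_Pair[OF bounded_linear_compose[OF that bounded_linear_fst]
        bounded_linear_compose[OF that bounded_linear_snd]], of k] by simp
  have "(\<lambda>p. z_join n (fst p) (snd p)) = (\<lambda>p.
     (vec_append k0 (fst (fst p)) (fst (snd p)),
      vec_append k1 (fst (snd (fst p))) (fst (snd (snd p))),
      vec_append k2 (fst (snd (snd (fst p)))) (fst (snd (snd (snd p)))),
      vec_append k3 (snd (snd (snd (fst p)))) (snd (snd (snd (snd p))))))"
    by (auto simp: n z_join_def)
  then show ?thesis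
    by (simp only:) (intro bounded_linear_Pair *[of fst] *[of "\<lambda>u. fst (snd u)"]
      *[of "\<lambda>u. fst (snd (snd u))"] *[of "\<lambda>u. snd (snd (snd u))"]
        bounded_linear_fst_comp bounded_linear_snd_comp bounded_linear_fst bounded_linear_snd)
qed


section \<open>Parameters of PI operators as kernels\<close>

lemma L2_fun_cut:
  assumes "L2_fun S f"
  shows "(\<lambda>x. indicat_real S x * f x) \<in> borel_measurable lborel"
    and "(\<integral>\<^sup>+x. ennreal ((indicat_real S x * f x)\<^sup>2) \<partial>lborel) < \<infinity>"
proof -
  show "(\<lambda>x. indicat_real S x * f x) \<in> borel_measurable lborel"
    using assms by (simp add: L2_fun_def set_borel_measurable_def)
  have "integrable lborel (\<lambda>x. indicat_real S x * (f x)\<^sup>2)"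
    using assms by (simp add: L2_fun_def set_integrable_def)
  then have "(\<integral>\<^sup>+x. ennreal (indicat_real S x * (f x)\<^sup>2) \<partial>lborel) < \<infinity>"
    by (subst nn_integral_eq_integral) auto
  also have "(\<lambda>x. indicat_real S x * (f x)\<^sup>2) = (\<lambda>x. (indicat_real S x * f x)\<^sup>2)"
    by (auto simp: indicator_def)
  finally show "(\<integral>\<^sup>+x. ennreal ((indicat_real S x * f x)\<^sup>2) \<partial>lborel) < \<infinity>" .
qed

text \<open>
  Parameters are square-integrable only on a square, and arbitrary outside. Cutting them off to a
  subset of the square turns integration over a variable interval into a kernel operator on the plane.
\<close>

lemma L2_kernel_cut:
  fixes k :: "real \<Rightarrow> real \<Rightarrow> real"
  assumes k: "L2_fun B (\<lambda>(x, y). k x y)" and S: "S \<in> sets borel" "S \<subseteq> B"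
  shows "L2_kernel lborel lborel (\<lambda>x y. indicat_real S (x, y) * k x y)"
proof -
  let ?f = "\<lambda>z. indicat_real B z * case_prod k z"
  have [measurable]: "S \<in> sets borel" "?f \<in> borel_measurable borel"
    using L2_fun_cut(1)[OF k] S(1) by simp_all
  have eq: "case_prod (\<lambda>x y. indicat_real S (x, y) * k x y) = (\<lambda>z. indicat_real S z * ?f z)"
    using S(2) by (auto simp: indicator_def fun_eq_iff)
  have eq2: "(\<lambda>(x, y). ennreal ((indicat_real S (x, y) * k x y)\<^sup>2)) =
      (\<lambda>z. ennreal ((indicat_real S z * ?f z)\<^sup>2))"
    using S(2) by (auto simp: indicator_def fun_eq_iff)
  have "(\<integral>\<^sup>+z. ennreal ((indicat_real S z * ?f z)\<^sup>2) \<partial>lborel) \<le> (\<integral>\<^sup>+z. ennreal ((?f z)\<^sup>2) \<partial>lborel)"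
    by (rule nn_integral_mono) (auto simp: indicator_def)
  also have "\<dots> < \<infinity>" by (rule L2_fun_cut(2)[OF k])
  finally have "(\<integral>\<^sup>+z. ennreal ((indicat_real S z * ?f z)\<^sup>2) \<partial>lborel) < \<infinity>" .
  moreover have "(\<lambda>z. indicat_real S z * ?f z) \<in> borel_measurable borel" by measurable
  ultimately show ?thesis
    unfolding L2_kernel_def lborel_prod eq eq2 by simp
qed

text \<open>The triangle on which the kernel of an integral from \<open>a\<close> to \<open>x\<close> lives.\<close>

definition below_diag :: "real \<Rightarrow> real \<Rightarrow> (real \<times> real) set" where
  "below_diag a b = {(x, \<theta>). a \<le> \<theta> \<and> \<theta> \<le> x \<and> x \<le> b}"

text \<open>The triangle on which the kernel of an integral from \<open>x\<close> to \<open>b\<close> lives.\<close>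

definition above_diag :: "real \<Rightarrow> real \<Rightarrow> (real \<times> real) set" where
  "above_diag a b = {(x, \<theta>). a \<le> x \<and> x \<le> \<theta> \<and> \<theta> \<le> b}"

lemma diag_borel: "below_diag a b \<in> sets borel" "above_diag a b \<in> sets borel"
proof -
  have "closed {z :: real \<times> real. a \<le> snd z \<and> snd z \<le> fst z \<and> fst z \<le> b}"
    "closed {z :: real \<times> real. a \<le> fst z \<and> fst z \<le> snd z \<and> snd z \<le> b}"
    by (intro closed_Collect_conj closed_Collect_le continuous_intros)+
  then show "below_diag a b \<in> sets borel" "above_diag a b \<in> sets borel"
    unfolding below_diag_def above_diag_def by (auto simp: case_prod_unfold intro: borel_closed)
qed

lemma diag_subset: "below_diag a b \<subseteq> {a..b} \<times> {a..b}" "above_diag a b \<subseteq> {a..b} \<times> {a..b}"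
  by (auto simp: below_diag_def above_diag_def)

lemma indicator_diag:
  "indicat_real (below_diag a b) (x, \<theta>) = indicat_real {a..b} x * indicat_real {a..x} \<theta>"
  "indicat_real (above_diag a b) (x, \<theta>) = indicat_real {a..b} x * indicat_real {x..b} \<theta>"
  by (auto simp: below_diag_def above_diag_def indicator_def)

lemma L2_kernel_diag:
  fixes c d :: real
  shows "L2_kernel lborel lborel (\<lambda>x y. indicat_real (below_diag c d) (x, y))"
    "L2_kernel lborel lborel (\<lambda>x y. indicat_real (above_diag c d) (x, y))"
proof -
  have "integrable lborel (indicat_real ({c..d} \<times> {c..d}))"
    using emeasure_lborel_cbox_finite[of "(c, c)" "(d, d)"]
    by (intro integrable_real_indicator) (auto simp: cbox_Pair_eq intro!: borel_closed closed_Times)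
  then have *: "L2_fun ({c..d} \<times> {c..d}) (\<lambda>(x, y). (1 :: real))"
    by (simp add: L2_fun_def set_borel_measurable_def set_integrable_def case_prod_unfold
        borel_measurable_integrable)
  show "L2_kernel lborel lborel (\<lambda>x y. indicat_real (below_diag c d) (x, y))"
    "L2_kernel lborel lborel (\<lambda>x y. indicat_real (above_diag c d) (x, y))"
    using L2_kernel_cut[OF * diag_borel(1) diag_subset(1)]
      L2_kernel_cut[OF * diag_borel(2) diag_subset(2)] by simp_all
qed

lemma indicator_interval_L2:
  fixes c d :: real
  shows "(\<integral>\<^sup>+x. ennreal ((indicat_real {c..d} x)\<^sup>2) \<partial>lborel) < \<infinity>"
proof -
  have "(\<integral>\<^sup>+x. ennreal ((indicat_real {c..d} x)\<^sup>2) \<partial>lborel) = (\<integral>\<^sup>+x. indicator {c..d} x \<partial>lborel)"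
    by (rule nn_integral_cong) (auto simp: indicator_def)
  then show ?thesis by (simp add: emeasure_lborel_Icc_eq)
qed


section \<open>4-PI operators and integration in the second variable\<close>

context
  fixes V :: "'v::real_normed_vector set" and M :: "'a measure"
  assumes V: "subspace V" and M: "sigma_finite_measure M"
begin

text \<open>
  The three ways in which a PI operator integrates over \<open>y\<close> are kernel operators in the second
  variable. The cut-off \<open>indicat_real {c..d} y\<close> is there because a primitive need not be
  square-integrable over the whole line.
\<close>

lemma L2_map_set_integral:
  fixes G :: "'v \<Rightarrow> 'a \<Rightarrow> real \<Rightarrow> real"
  assumes "L2_map V M lborel G"
  shows "L2_map V M pt (\<lambda>u x _. LINT \<nu>:{c..d}|lborel. G u x \<nu>)"
proof -
  have "L2_kernel pt lborel (\<lambda>_ \<nu>. indicat_real {c..d} \<nu>)"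
    by (rule L2_kernel_swap[OF sigma_finite_lborel sigma_finite_pt L2_kernel_pt])
      (rule indicator_interval_L2 | simp)+
  from L2_map_kernel_right[OF V M sigma_finite_lborel sigma_finite_pt this assms]
  show ?thesis by (simp add: set_lebesgue_integral_def)
qed

lemma L2_map_integral_below:
  fixes G :: "'v \<Rightarrow> 'a \<Rightarrow> real \<Rightarrow> real"
  assumes "L2_map V M lborel G"
  shows "L2_map V M lborel (\<lambda>u x y. indicat_real {c..d} y * (LINT \<nu>:{c..y}|lborel. G u x \<nu>))"
  using L2_map_kernel_right[OF V M sigma_finite_lborel sigma_finite_lborel L2_kernel_diag(1) assms, of c d]
  by (simp add: set_lebesgue_integral_def indicator_diag mult.assoc)

lemma L2_map_integral_above:
  fixes G :: "'v \<Rightarrow> 'a \<Rightarrow> real \<Rightarrow> real"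
  assumes "L2_map V M lborel G"
  shows "L2_map V M lborel (\<lambda>u x y. indicat_real {c..d} y * (LINT \<nu>:{y..d}|lborel. G u x \<nu>))"
  using L2_map_kernel_right[OF V M sigma_finite_lborel sigma_finite_lborel L2_kernel_diag(2) assms, of c d]
  by (simp add: set_lebesgue_integral_def indicator_diag mult.assoc)

lemma L2_map_const_right:
  fixes c d :: real
  assumes "L2_map V M pt H"
  shows "L2_map V M lborel (\<lambda>u x y. indicat_real {c..d} y * H u x ())"
  by (rule L2_map_swap[OF sigma_finite_lborel M L2_map_pt_left[OF V sigma_finite_lborel M _ _
      L2_map_swap[OF M sigma_finite_pt assms]]])
    (rule indicator_interval_L2 | simp)+

lemma L2_map_cut_right:
  fixes G :: "'v \<Rightarrow> 'a \<Rightarrow> real \<Rightarrow> real"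
  assumes "L2_map V M lborel G"
  shows "L2_map V M lborel (\<lambda>u x y. indicat_real {c..d} y * G u x y)"
  by (rule L2_map_swap[OF sigma_finite_lborel M L2_map_mult[OF
      L2_map_swap[OF M sigma_finite_lborel assms] sigma_finite_lborel M, where K = 1]])
    (auto split: split_indicator)

text \<open>
  The arguments of the 4-PI operator are the coordinates \<open>F0\<close>, \<open>F1\<close> of an \<open>L2\<close> map, and \<open>M\<close> carries
  the variable in which the operator is a multiplier: one point for the first pair of components of
  \<open>Z\<close>, the real line for the second.
\<close>

lemma L2_map_pi4_fin:
  assumes P: "pi4_valid a b (n0, n1) (m0, m1) P" and i: "i < m0"
    and F0: "\<And>j. L2_map V pt M (F0 j)" and F1: "\<And>j. L2_map V lborel M (F1 j)"
  shows "L2_map V pt M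
    (\<lambda>u _ y. pi4_fin a b (n0, n1) P (\<lambda>j. F0 j u () y, \<lambda>j x. F1 j u x y) i)"
proof -
  have k: "L2_kernel pt lborel (\<lambda>_ \<theta>. indicat_real {a..b} \<theta> * B01 P i j \<theta>)" if "j < n1" for j
  proof -
    have "L2_fun {a..b} (B01 P i j)" using P i that by (simp add: pi4_valid_def)
    from L2_fun_cut[OF this] show ?thesis
      by (intro L2_kernel_swap[OF sigma_finite_lborel sigma_finite_pt L2_kernel_pt])
  qed
  have "L2_map V pt M (\<lambda>u x y. (\<Sum>j<n0. B00 P i j * F0 j u x y) +
      (\<integral>\<theta>. (\<Sum>j<n1. (indicat_real {a..b} \<theta> * B01 P i j \<theta>) * F1 j u \<theta> y) \<partial>lborel))"
    using M by (intro L2_map_add L2_map_sum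
        L2_map_kernel_sum[OF V sigma_finite_pt sigma_finite_lborel M k F1]
        L2_map_mult[OF F0 sigma_finite_pt, where K = "\<bar>B00 P i j\<bar>" for j]) auto
  then show ?thesis
    by (simp add: pi4_fin_def set_lebesgue_integral_def sum_distrib_left mult.assoc)
qed

text \<open>
  The four terms are a tensor product, a bounded multiplier, and two kernel operators on the triangles
  below and above the diagonal. Cutting off in \<open>x\<close> is needed because the parameters are arbitrary
  outside the interval.
\<close>

lemma L2_map_pi4_dist:
  assumes P: "pi4_valid a b (n0, n1) (m0, m1) P" and i: "i < m1"
    and F0: "\<And>j. L2_map V pt M (F0 j)" and F1: "\<And>j. L2_map V lborel M (F1 j)"
  shows "L2_map V lborel M
    (\<lambda>u x y. indicat_real {a..b} x *
      pi4_dist a b (n0, n1) P (\<lambda>j. F0 j u () y, \<lambda>j x. F1 j u x y) i x)"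
proof -
  have b10: "L2_map V lborel M (\<lambda>u x y. (indicat_real {a..b} x * B10 P i j x) * F0 j u () y)"
    if "j < n0" for j
  proof -
    have "L2_fun {a..b} (B10 P i j)" using P i that by (simp add: pi4_valid_def)
    from L2_map_pt_left[OF V sigma_finite_lborel M L2_fun_cut[OF this] F0] show ?thesis .
  qed
  have r0: "L2_map V lborel M (\<lambda>u x y. (indicat_real {a..b} x * R0 P i j x) * F1 j u x y)"
    if "j < n1" for j
  proof -
    have "Linf_fun {a..b} (R0 P i j)" using P i that by (simp add: pi4_valid_def)
    then obtain K where K: "AE x in lborel. x \<in> {a..b} \<longrightarrow> \<bar>R0 P i j x\<bar> \<le> K"
      and m: "(\<lambda>x. indicat_real {a..b} x * R0 P i j x) \<in> borel_measurable lborel"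
      by (auto simp: Linf_fun_def set_borel_measurable_def)
    \<comment> \<open>Off the interval the product is 0, so the bound must be nonnegative as well.\<close>
    from K have "AE x in lborel. \<bar>indicat_real {a..b} x * R0 P i j x\<bar> \<le> max 0 K"
      by eventually_elim (auto simp: indicator_def)
    from L2_map_mult[OF F1 sigma_finite_lborel M m this] show ?thesis .
  qed
  have k1: "L2_kernel lborel lborel (\<lambda>x \<theta>. indicat_real (below_diag a b) (x, \<theta>) * R1 P i j x \<theta>)"
    if "j < n1" for j
    by (rule L2_kernel_cut[OF _ diag_borel(1) diag_subset(1)])
      (use P i that in \<open>simp add: pi4_valid_def\<close>)
  have k2: "L2_kernel lborel lborel (\<lambda>x \<theta>. indicat_real (above_diag a b) (x, \<theta>) * R2 P i j x \<theta>)"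
    if "j < n1" for j
    by (rule L2_kernel_cut[OF _ diag_borel(2) diag_subset(2)])
      (use P i that in \<open>simp add: pi4_valid_def\<close>)
  note ker = L2_map_kernel_sum[OF V sigma_finite_lborel sigma_finite_lborel M]
  have "L2_map V lborel M (\<lambda>u x y.
      (\<Sum>j<n0. (indicat_real {a..b} x * B10 P i j x) * F0 j u () y) +
      (\<Sum>j<n1. (indicat_real {a..b} x * R0 P i j x) * F1 j u x y) +
      (\<integral>\<theta>. (\<Sum>j<n1. (indicat_real (below_diag a b) (x, \<theta>) * R1 P i j x \<theta>) * F1 j u \<theta> y) \<partial>lborel) +
      (\<integral>\<theta>. (\<Sum>j<n1. (indicat_real (above_diag a b) (x, \<theta>) * R2 P i j x \<theta>) * F1 j u \<theta> y) \<partial>lborel))"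
    by (intro L2_map_add L2_map_sum b10 r0 ker[OF k1 F1] ker[OF k2 F1]) auto
  then show ?thesis
    by (simp add: pi4_dist_def set_lebesgue_integral_def indicator_diag mult.assoc distrib_left
        flip: sum_distrib_left)
qed

end


section \<open>From coordinates to functions and back\<close>

lemma L2_map_coord_pt:
  assumes "bounded_linear f"
  shows "L2_map V pt pt (\<lambda>u _ _. f u)"
proof (rule L2_mapI)
  interpret bounded_linear f by fact
  fix u :: 'a
  have "(\<integral>\<^sup>+(x, y). ennreal ((f u)\<^sup>2) \<partial>(pt \<Otimes>\<^sub>M pt)) = ennreal ((f u)\<^sup>2)"
    by (subst nn_integral_pair_pt) (simp_all add: nn_integral_pt case_prod_unfold)
  moreover have "(norm (f u))\<^sup>2 \<le> (norm u * onorm f)\<^sup>2"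
    using onorm[OF assms, of u] by (intro power_mono) (auto simp: mult.commute)
  ultimately show "(\<integral>\<^sup>+(x, y). ennreal ((f u)\<^sup>2) \<partial>(pt \<Otimes>\<^sub>M pt)) \<le> ennreal ((onorm f)\<^sup>2 * (norm u)\<^sup>2)"
    by (simp add: ennreal_leI power_mult_distrib mult.commute)
  fix w r
  show "AE (x, y) in pt \<Otimes>\<^sub>M pt. f (u + r *\<^sub>R w) = f u + r * f w"
    by (simp add: add scaleR case_prod_unfold)
qed (auto simp: case_prod_unfold)

lemma lsq_coord:
  fixes f :: "'v::real_normed_vector \<Rightarrow> 'a::euclidean_space lsq"
  assumes "bounded_linear f"
  shows "AE x in lborel. rep_lsq (f (u + r *\<^sub>R w)) x = rep_lsq (f u) x + r * rep_lsq (f w) x"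
    and "(\<integral>\<^sup>+x. ennreal ((rep_lsq (f u) x)\<^sup>2) \<partial>lborel) \<le> ennreal ((onorm f)\<^sup>2 * (norm u)\<^sup>2)"
proof -
  interpret bounded_linear f by fact
  show "AE x in lborel. rep_lsq (f (u + r *\<^sub>R w)) x = rep_lsq (f u) x + r * rep_lsq (f w) x"
    using rep_lsq_add[of "f u" "r *\<^sub>R f w"] rep_lsq_scaleR[of r "f w"]
    unfolding add scaleR by eventually_elim simp
  have "(norm (f u))\<^sup>2 \<le> (norm u * onorm f)\<^sup>2"
    using onorm[OF assms, of u] by (intro power_mono) (auto simp: mult.commute)
  then show "(\<integral>\<^sup>+x. ennreal ((rep_lsq (f u) x)\<^sup>2) \<partial>lborel) \<le> ennreal ((onorm f)\<^sup>2 * (norm u)\<^sup>2)"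
    by (simp add: nn_integral_rep_lsq ennreal_leI power_mult_distrib mult.commute)
qed

lemma L2_map_coord_lborel_pt:
  fixes f :: "'v::real_normed_vector \<Rightarrow> 'a::euclidean_space lsq"
  assumes f: "bounded_linear f"
  shows "L2_map V lborel pt (\<lambda>u x _. rep_lsq (f u) x)"
proof (rule L2_mapI[where C = "(onorm f)\<^sup>2"])
  fix u w r
  show "AE (x, y) in lborel \<Otimes>\<^sub>M pt. rep_lsq (f (u + r *\<^sub>R w)) x = rep_lsq (f u) x + r * rep_lsq (f w) x"
    by (rule AE_pair_fst[OF sigma_finite_lborel sigma_finite_pt lsq_coord(1)[OF f]])
  show "(\<integral>\<^sup>+(x, y). ennreal ((rep_lsq (f u) x)\<^sup>2) \<partial>(lborel \<Otimes>\<^sub>M pt)) \<le> ennreal ((onorm f)\<^sup>2 * (norm u)\<^sup>2)"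
    by (subst nn_integral_pair_pt) (simp_all add: pt_pair_measurable lsq_coord(2)[OF f])
qed (simp_all add: pt_pair_measurable)

lemma L2_map_coord_lborel_lborel:
  fixes f :: "'v::real_normed_vector \<Rightarrow> (real \<times> real) lsq"
  assumes f: "bounded_linear f"
  shows "L2_map V lborel lborel (\<lambda>u x y. rep_lsq (f u) (x, y))"
proof (rule L2_mapI[where C = "(onorm f)\<^sup>2"])
  fix u w r
  show "AE (x, y) in lborel \<Otimes>\<^sub>M lborel.
      rep_lsq (f (u + r *\<^sub>R w)) (x, y) = rep_lsq (f u) (x, y) + r * rep_lsq (f w) (x, y)"
    using lsq_coord(1)[OF f, of u r w] unfolding lborel_prod by (auto elim!: eventually_mono)
  show "(\<integral>\<^sup>+(x, y). ennreal ((rep_lsq (f u) (x, y))\<^sup>2) \<partial>(lborel \<Otimes>\<^sub>M lborel)) \<le> ennreal ((onorm f)\<^sup>2 * (norm u)\<^sup>2)"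
    using lsq_coord(2)[OF f, of u] by (simp add: lborel_prod case_prod_unfold)
qed (simp_all add: lborel_prod)

lemma bounded_linear_on_real:
  assumes "L2_map V pt pt F" "\<And>u. u \<in> V \<Longrightarrow> f u = F u () ()"  "subspace V"
  shows "bounded_linear_on V f"
proof -
  from assms(1) obtain C where F: "\<And>u. u \<in> V \<Longrightarrow> case_prod (F u) \<in> borel_measurable (pt \<Otimes>\<^sub>M pt)"
    "\<And>u w r. u \<in> V \<Longrightarrow> w \<in> V \<Longrightarrow>
      AE (x, y) in pt \<Otimes>\<^sub>M pt. F (u + r *\<^sub>R w) x y = F u x y + r * F w x y"
    "0 \<le> C" "\<And>u. u \<in> V \<Longrightarrow>
      (\<integral>\<^sup>+(x, y). ennreal ((F u x y)\<^sup>2) \<partial>(pt \<Otimes>\<^sub>M pt)) \<le> ennreal (C * (norm u)\<^sup>2)"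
    by (rule L2_mapE) (rule that)
  show ?thesis unfolding bounded_linear_on_def
  proof (intro conjI ballI allI exI)
    fix u w r assume uw: "u \<in> V" "w \<in> V"
    then have "u + r *\<^sub>R w \<in> V" using assms(3) by (simp add: subspace_add subspace_scale)
    then show "f (u + r *\<^sub>R w) = f u + r *\<^sub>R f w"
      using AE_pair_pt[OF sigma_finite_pt F(2)[OF uw, of r]] uw assms(2)
      by (simp add: AE_count_space)
  next
    fix u assume u: "u \<in> V"
    have "(\<lambda>(x, y). ennreal ((F u x y)\<^sup>2)) \<in> borel_measurable (pt \<Otimes>\<^sub>M pt)"
      using F(1)[OF u] by (auto simp: case_prod_unfold)
    from nn_integral_pair_pt[OF this] have "ennreal ((f u)\<^sup>2) \<le> ennreal (C * (norm u)\<^sup>2)"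
      using F(4)[OF u] assms(2)[OF u] by (simp add: nn_integral_pt)
    then have "(f u)\<^sup>2 \<le> C * (norm u)\<^sup>2"
      using F(3) by (subst (asm) ennreal_le_iff) auto
    then have "sqrt ((f u)\<^sup>2) \<le> sqrt (C * (norm u)\<^sup>2)" by (rule real_sqrt_le_mono)
    then show "norm (f u) \<le> sqrt C * norm u" by (simp add: real_sqrt_mult)
  qed
qed

text \<open>
  The way back from functions to classes: a map into \<open>lsq_on S\<close> that is represented on \<open>S\<close> by an \<open>L2\<close>
  map is linear and bounded.
\<close>

lemma bounded_linear_on_lsq:
  fixes f :: "'v::real_normed_vector \<Rightarrow> 'a::euclidean_space lsq"
  assumes V: "subspace V" and S: "\<And>u. u \<in> V \<Longrightarrow> f u \<in> lsq_on S"
    and eq: "\<And>u. u \<in> V \<Longrightarrow> AE x in lborel. x \<in> S \<longrightarrow> rep_lsq (f u) x = F u x"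
    and F: "L2_map V lborel pt (\<lambda>u x _. F u x)"
  shows "bounded_linear_on V f"
proof -
  from F obtain C where F: "\<And>u. u \<in> V \<Longrightarrow> (\<lambda>(x, y). F u x) \<in> borel_measurable (lborel \<Otimes>\<^sub>M pt)"
    "\<And>u w r. u \<in> V \<Longrightarrow> w \<in> V \<Longrightarrow>
      AE (x, y) in lborel \<Otimes>\<^sub>M pt. F (u + r *\<^sub>R w) x = F u x + r * F w x"
    "0 \<le> C" "\<And>u. u \<in> V \<Longrightarrow>
      (\<integral>\<^sup>+(x, y). ennreal ((F u x)\<^sup>2) \<partial>(lborel \<Otimes>\<^sub>M pt)) \<le> ennreal (C * (norm u)\<^sup>2)"
    by (rule L2_mapE) (rule that)
  \<comment> \<open>On \<open>S\<close> the class is represented by \<open>F u\<close>; off \<open>S\<close> it vanishes, which can only decrease the norm.\<close>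
  have out: "AE x in lborel. x \<notin> S \<longrightarrow> rep_lsq (f u) x = 0" if "u \<in> V" for u
    using S[OF that] by (simp add: lsq_on_def)
  show ?thesis unfolding bounded_linear_on_def
  proof (intro conjI ballI allI exI)
    fix u w r assume uw: "u \<in> V" "w \<in> V"
    then have s: "u + r *\<^sub>R w \<in> V" using V by (simp add: subspace_add subspace_scale)
    show "f (u + r *\<^sub>R w) = f u + r *\<^sub>R f w"
    proof (rule lsq_eqI)
      show "AE x in lborel. rep_lsq (f (u + r *\<^sub>R w)) x = rep_lsq (f u + r *\<^sub>R f w) x"
        using AE_pair_pt[OF sigma_finite_lborel F(2)[OF uw, of r]] eq[OF s] eq[OF uw(1)] eq[OF uw(2)]
          out[OF s] out[OF uw(1)] out[OF uw(2)]
          rep_lsq_add[of "f u" "r *\<^sub>R f w"] rep_lsq_scaleR[of r "f w"]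
      proof eventually_elim
        case (elim x)
        then show ?case by (cases "x \<in> S") auto
      qed
    qed
  next
    fix u assume u: "u \<in> V"
    have "ennreal ((norm (f u))\<^sup>2) = (\<integral>\<^sup>+x. ennreal ((rep_lsq (f u) x)\<^sup>2) \<partial>lborel)"
      by (simp add: nn_integral_rep_lsq)
    also have "\<dots> \<le> (\<integral>\<^sup>+x. ennreal ((F u x)\<^sup>2) \<partial>lborel)"
    proof (rule nn_integral_mono_AE)
      show "AE x in lborel. ennreal ((rep_lsq (f u) x)\<^sup>2) \<le> ennreal ((F u x)\<^sup>2)"
        using eq[OF u] out[OF u]
      proof eventually_elim
        case (elim x)
        then show ?case by (cases "x \<in> S") auto
      qed
    qed
    also have "\<dots> = (\<integral>\<^sup>+(x, y). ennreal ((F u x)\<^sup>2) \<partial>(lborel \<Otimes>\<^sub>M pt))"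
      by (rule nn_integral_pair_pt[symmetric]) (use F(1)[OF u] in \<open>simp add: pt_pair_measurable\<close>)
    also have "\<dots> \<le> ennreal (C * (norm u)\<^sup>2)" by (rule F(4)[OF u])
    finally have "(norm (f u))\<^sup>2 \<le> C * (norm u)\<^sup>2"
      using F(3) by (subst (asm) ennreal_le_iff) auto
    then have "sqrt ((norm (f u))\<^sup>2) \<le> sqrt (C * (norm u)\<^sup>2)" by (rule real_sqrt_le_mono)
    then show "norm (f u) \<le> sqrt C * norm u" by (simp add: real_sqrt_mult)
  qed
qed

text \<open>
  A function of two variables is a function of the pair and a dummy variable, so that one criterion
  covers the components on an interval and on the rectangle.
\<close>

lemma L2_map_pair_pt:
  fixes F :: "'v::real_normed_vector \<Rightarrow> real \<times> real \<Rightarrow> real"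
  assumes "L2_map V lborel lborel (\<lambda>u x y. F u (x, y))"
  shows "L2_map V lborel pt (\<lambda>u z _. F u z)"
proof -
  from assms obtain C where F: "\<And>u. u \<in> V \<Longrightarrow> (\<lambda>(x, y). F u (x, y)) \<in> borel_measurable (lborel \<Otimes>\<^sub>M lborel)"
    "\<And>u w r. u \<in> V \<Longrightarrow> w \<in> V \<Longrightarrow>
      AE (x, y) in lborel \<Otimes>\<^sub>M lborel. F (u + r *\<^sub>R w) (x, y) = F u (x, y) + r * F w (x, y)"
    "0 \<le> C" "\<And>u. u \<in> V \<Longrightarrow>
      (\<integral>\<^sup>+(x, y). ennreal ((F u (x, y))\<^sup>2) \<partial>(lborel \<Otimes>\<^sub>M lborel)) \<le> ennreal (C * (norm u)\<^sup>2)"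
    by (rule L2_mapE) (rule that)
  show ?thesis
  proof (rule L2_mapI[OF _ _ F(3)])
    fix u assume u: "u \<in> V"
    show m: "(\<lambda>(x, y). F u x) \<in> borel_measurable (lborel \<Otimes>\<^sub>M pt)"
      using F(1)[OF u] by (simp add: pt_pair_measurable lborel_prod)
    then have "(\<lambda>(x, y). ennreal ((F u x)\<^sup>2)) \<in> borel_measurable (lborel \<Otimes>\<^sub>M pt)"
      by (simp add: pt_pair_measurable)
    from nn_integral_pair_pt[OF this]
    show "(\<integral>\<^sup>+(x, y). ennreal ((F u x)\<^sup>2) \<partial>(lborel \<Otimes>\<^sub>M pt)) \<le> ennreal (C * (norm u)\<^sup>2)"
      using F(4)[OF u] by (simp add: lborel_prod case_prod_unfold)
  next
    fix u w r assume "u \<in> V" "w \<in> V"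
    from F(2)[OF this, of r, unfolded lborel_prod]
    show "AE (x, y) in lborel \<Otimes>\<^sub>M pt. F (u + r *\<^sub>R w) x = F u x + r * F w x"
      by (intro AE_pair_fst[OF sigma_finite_lborel sigma_finite_pt]) (simp add: case_prod_unfold)
  qed
qed


section \<open>PI operators are linear and bounded\<close>

text \<open>
  The condition that \<open>w\<close> is the image of \<open>u\<close> under the PI operator with parameters \<open>K\<close>, written with
  projections instead of tuples so that it depends on \<open>u\<close> as a vector of \<open>Z\<close>.
\<close>

definition pi_output :: "real \<Rightarrow> real \<Rightarrow> real \<Rightarrow> real \<Rightarrow> dims \<Rightarrow> dims \<Rightarrow> pi_params \<Rightarrow> zspace \<Rightarrow> zspace \<Rightarrow> bool"
  where
  "pi_output a b c d = (\<lambda>(n0, n1, n2, n3) (m0, m1, m2, m3) K u w.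
     let p1 = (lookup (fst u), \<lambda>j. rep_lsq (lookup (fst (snd u)) j));
         p2 = (\<lambda>y. (\<lambda>j. rep_lsq (lookup (fst (snd (snd u))) j) y,
                \<lambda>j x. rep_lsq (lookup (snd (snd (snd u))) j) (x, y)));
         fin1 = pi4_fin a b (n0, n1);
         dist1 = pi4_dist a b (n0, n1);
         fin2 = pi4_fin a b (n2, n3);
         dist2 = pi4_dist a b (n2, n3)
     in
       (\<forall>i<m0. lookup (fst w) i =
          fin1 (B11 K) p1 i + (LINT y:{c..d}|lborel. fin2 (B12 K) (p2 y) i)) \<and>
       (\<forall>i<m1. AE x in lborel. x \<in> {a..b} \<longrightarrow> rep_lsq (lookup (fst (snd w)) i) x =
          dist1 (B11 K) p1 i x + (LINT y:{c..d}|lborel. dist2 (B12 K) (p2 y) i x)) \<and>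
       (\<forall>i<m2. AE y in lborel. y \<in> {c..d} \<longrightarrow> rep_lsq (lookup (fst (snd (snd w))) i) y =
          fin1 (B21 K) p1 i + fin2 (N0 K) (p2 y) i +
          (LINT \<nu>:{c..y}|lborel. fin2 (N1 K) (p2 \<nu>) i) +
          (LINT \<nu>:{y..d}|lborel. fin2 (N2 K) (p2 \<nu>) i)) \<and>
       (\<forall>i<m3. AE (x, y) in lborel. (x, y) \<in> {a..b} \<times> {c..d} \<longrightarrow>
          rep_lsq (lookup (snd (snd (snd w))) i) (x, y) =
          dist1 (B21 K) p1 i x + dist2 (N0 K) (p2 y) i x +
          (LINT \<nu>:{c..y}|lborel. dist2 (N1 K) (p2 \<nu>) i x) +
          (LINT \<nu>:{y..d}|lborel. dist2 (N2 K) (p2 \<nu>) i x)))"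

lemma pi_operatorE:
  assumes "pi_operator a b c d (n0, n1, n2, n3) (m0, m1, m2, m3) P"
  obtains K where "pi_valid a b (n0, n1, n2, n3) (m0, m1, m2, m3) K"
    and "\<And>u. u \<in> Z a b c d (n0, n1, n2, n3) \<Longrightarrow> P u \<in> Z a b c d (m0, m1, m2, m3)"
    and "\<And>u. u \<in> Z a b c d (n0, n1, n2, n3) \<Longrightarrow>
      pi_output a b c d (n0, n1, n2, n3) (m0, m1, m2, m3) K u (P u)"
  using assms unfolding pi_operator_def pi_output_def prod.case
  apply (elim exE conjE)
  apply (rule that)
    apply assumption
  subgoal for K u
    by (drule (1) bspec, cases u, simp only: prod.case, elim exE conjE, simp only:)
  subgoal for K u
    by (drule (1) bspec, cases u, simp only: prod.case pi_output_def, elim exE conjE,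
        simp only: fst_conv snd_conv)
  done

lemma pi_operator_maps:
  assumes "pi_operator a b c d n m P" "u \<in> Z a b c d n"
  shows "P u \<in> Z a b c d m"
proof -
  obtain n0 n1 n2 n3 m0 m1 m2 m3 where nm: "n = (n0, n1, n2, n3)" "m = (m0, m1, m2, m3)"
    by (cases n, cases m)
  show ?thesis
  proof (rule pi_operatorE[OF assms(1)[unfolded nm]])
    assume "\<And>u. u \<in> Z a b c d (n0, n1, n2, n3) \<Longrightarrow> P u \<in> Z a b c d (m0, m1, m2, m3)"
    then show ?thesis using assms(2) unfolding nm .
  qed
qed

text \<open>
  Each component of the output agrees on its domain with a sum of compositions of a 4-PI operator in
  \<open>x\<close> and an integration, multiplication by a cut-off or extension as a constant in \<open>y\<close>, applied to the
  coordinates of the argument. All of these preserve \<open>L2_map\<close>.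
\<close>

lemma pi_operator_bounded_linear_on:
  assumes "pi_operator a b c d n m P"
  shows "bounded_linear_on (Z a b c d n) P"
proof -
  obtain n0 n1 n2 n3 m0 m1 m2 m3 where nm: "n = (n0, n1, n2, n3)" "m = (m0, m1, m2, m3)"
    by (cases n, cases m)
  let ?V = "Z a b c d (n0, n1, n2, n3)"
  note V = subspace_Z[of a b c d "(n0, n1, n2, n3)"]
  from assms obtain K where K: "pi_valid a b (n0, n1, n2, n3) (m0, m1, m2, m3) K"
    and PZ: "\<And>u. u \<in> ?V \<Longrightarrow> P u \<in> Z a b c d (m0, m1, m2, m3)"
    and P: "\<And>u. u \<in> ?V \<Longrightarrow> pi_output a b c d (n0, n1, n2, n3) (m0, m1, m2, m3) K u (P u)"
    unfolding nm by (rule pi_operatorE) (rule that)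
  \<comment> \<open>The arguments that the parameters act on: \<open>p1\<close> is a single element, \<open>p2\<close> is sliced along \<open>y\<close>.\<close>
  define p1 where "p1 u = (lookup (fst u), \<lambda>j. rep_lsq (lookup (fst (snd u)) j))" for u :: zspace
  define p2 where "p2 u y = (\<lambda>j. rep_lsq (lookup (fst (snd (snd u))) j) y,
      \<lambda>j x. rep_lsq (lookup (snd (snd (snd u))) j) (x, y))" for u :: zspace and y
  note out = P[unfolded pi_output_def prod.case Let_def, folded p1_def p2_def]
  have coord: "bounded_linear (\<lambda>u :: zspace. lookup (fst u) j)"
    "bounded_linear (\<lambda>u :: zspace. lookup (fst (snd u)) j)"
    "bounded_linear (\<lambda>u :: zspace. lookup (fst (snd (snd u))) j)"
    "bounded_linear (\<lambda>u :: zspace. lookup (snd (snd (snd u))) j)" for j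
    by (intro bounded_linear_compose[OF bounded_linear_lookup] bounded_linear_fst_comp
        bounded_linear_snd_comp bounded_linear_fst bounded_linear_snd)+
  note u0 = L2_map_coord_pt[OF coord(1)] and u1 = L2_map_coord_lborel_pt[OF coord(2)]
    and u2 = L2_map_swap[OF sigma_finite_lborel sigma_finite_pt L2_map_coord_lborel_pt[OF coord(3)]]
    and u3 = L2_map_coord_lborel_lborel[OF coord(4)]
  have fin1: "L2_map ?V pt pt (\<lambda>u _ _. pi4_fin a b (n0, n1) Q (p1 u) i)"
    if "pi4_valid a b (n0, n1) (k0, k1) Q" "i < k0" for Q k0 k1 i
    unfolding p1_def by (rule L2_map_pi4_fin[OF V sigma_finite_pt that u0 u1])
  have dist1: "L2_map ?V lborel pt (\<lambda>u x _. indicat_real {a..b} x * pi4_dist a b (n0, n1) Q (p1 u) i x)"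
    if "pi4_valid a b (n0, n1) (k0, k1) Q" "i < k1" for Q k0 k1 i
    unfolding p1_def by (rule L2_map_pi4_dist[OF V sigma_finite_pt that u0 u1])
  have fin2: "L2_map ?V pt lborel (\<lambda>u _ y. pi4_fin a b (n2, n3) Q (p2 u y) i)"
    if "pi4_valid a b (n2, n3) (k0, k1) Q" "i < k0" for Q k0 k1 i
    unfolding p2_def by (rule L2_map_pi4_fin[OF V sigma_finite_lborel that u2 u3])
  have dist2: "L2_map ?V lborel lborel (\<lambda>u x y. indicat_real {a..b} x * pi4_dist a b (n2, n3) Q (p2 u y) i x)"
    if "pi4_valid a b (n2, n3) (k0, k1) Q" "i < k1" for Q k0 k1 i
    unfolding p2_def by (rule L2_map_pi4_dist[OF V sigma_finite_lborel that u2 u3])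
  have valid: "pi4_valid a b (n0, n1) (m0, m1) (B11 K)" "pi4_valid a b (n2, n3) (m0, m1) (B12 K)"
    "pi4_valid a b (n0, n1) (m2, m3) (B21 K)" "pi4_valid a b (n2, n3) (m2, m3) (N0 K)"
    "pi4_valid a b (n2, n3) (m2, m3) (N1 K)" "pi4_valid a b (n2, n3) (m2, m3) (N2 K)"
    using K by (simp_all add: pi_valid_def)
  have PZ': "fst (P u) \<in> vecs m0 UNIV" "fst (snd (P u)) \<in> vecs m1 (lsq_on {a..b})"
    "fst (snd (snd (P u))) \<in> vecs m2 (lsq_on {c..d})"
    "snd (snd (snd (P u))) \<in> vecs m3 (lsq_on ({a..b} \<times> {c..d}))" if "u \<in> ?V" for u
    using PZ[OF that] by (auto simp: Z_def)
  have w0: "bounded_linear_on ?V (\<lambda>u. lookup (fst (P u)) i)" if i: "i < m0" for i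
  proof (rule bounded_linear_on_real[OF _ _ V])
    show "L2_map ?V pt pt (\<lambda>u _ _. pi4_fin a b (n0, n1) (B11 K) (p1 u) i +
        (LINT y:{c..d}|lborel. pi4_fin a b (n2, n3) (B12 K) (p2 u y) i))"
      by (intro L2_map_add fin1[OF valid(1) i]
          L2_map_set_integral[OF V sigma_finite_pt fin2[OF valid(2) i]])
  qed (use out i in blast)
  have w1: "bounded_linear_on ?V (\<lambda>u. lookup (fst (snd (P u))) i)" if i: "i < m1" for i
  proof (rule bounded_linear_on_lsq[OF V])
    show "L2_map ?V lborel pt (\<lambda>u x _. indicat_real {a..b} x * pi4_dist a b (n0, n1) (B11 K) (p1 u) i x +
        (LINT y:{c..d}|lborel. indicat_real {a..b} x * pi4_dist a b (n2, n3) (B12 K) (p2 u y) i x))"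
      by (intro L2_map_add dist1[OF valid(1) i]
          L2_map_set_integral[OF V sigma_finite_lborel dist2[OF valid(2) i]])
    fix u assume u: "u \<in> ?V"
    show "lookup (fst (snd (P u))) i \<in> lsq_on {a..b}"
      using PZ'(2)[OF u] i by (simp add: vecs_def)
    have "AE x in lborel. x \<in> {a..b} \<longrightarrow> rep_lsq (lookup (fst (snd (P u))) i) x =
        pi4_dist a b (n0, n1) (B11 K) (p1 u) i x +
        (LINT y:{c..d}|lborel. pi4_dist a b (n2, n3) (B12 K) (p2 u y) i x)"
      using out[OF u] i by blast
    then show "AE x in lborel. x \<in> {a..b} \<longrightarrow> rep_lsq (lookup (fst (snd (P u))) i) x =
        indicat_real {a..b} x * pi4_dist a b (n0, n1) (B11 K) (p1 u) i x +
        (LINT y:{c..d}|lborel. indicat_real {a..b} x * pi4_dist a b (n2, n3) (B12 K) (p2 u y) i x)"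
      by eventually_elim simp
  qed
  have w2: "bounded_linear_on ?V (\<lambda>u. lookup (fst (snd (snd (P u)))) i)" if i: "i < m2" for i
  proof (rule bounded_linear_on_lsq[OF V])
    show "L2_map ?V lborel pt (\<lambda>u y _.
        indicat_real {c..d} y * pi4_fin a b (n0, n1) (B21 K) (p1 u) i +
        indicat_real {c..d} y * pi4_fin a b (n2, n3) (N0 K) (p2 u y) i +
        indicat_real {c..d} y * (LINT \<nu>:{c..y}|lborel. pi4_fin a b (n2, n3) (N1 K) (p2 u \<nu>) i) +
        indicat_real {c..d} y * (LINT \<nu>:{y..d}|lborel. pi4_fin a b (n2, n3) (N2 K) (p2 u \<nu>) i))"
      by (rule L2_map_swap[OF sigma_finite_pt sigma_finite_lborel])
        (intro L2_map_add
          L2_map_const_right[OF V sigma_finite_pt fin1[OF valid(3) i]]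
          L2_map_cut_right[OF V sigma_finite_pt fin2[OF valid(4) i]]
          L2_map_integral_below[OF V sigma_finite_pt fin2[OF valid(5) i]]
          L2_map_integral_above[OF V sigma_finite_pt fin2[OF valid(6) i]])
    fix u assume u: "u \<in> ?V"
    show "lookup (fst (snd (snd (P u)))) i \<in> lsq_on {c..d}"
      using PZ'(3)[OF u] i by (simp add: vecs_def)
    have "AE y in lborel. y \<in> {c..d} \<longrightarrow> rep_lsq (lookup (fst (snd (snd (P u)))) i) y =
        pi4_fin a b (n0, n1) (B21 K) (p1 u) i + pi4_fin a b (n2, n3) (N0 K) (p2 u y) i +
        (LINT \<nu>:{c..y}|lborel. pi4_fin a b (n2, n3) (N1 K) (p2 u \<nu>) i) +
        (LINT \<nu>:{y..d}|lborel. pi4_fin a b (n2, n3) (N2 K) (p2 u \<nu>) i)"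
      using out[OF u] i by blast
    then show "AE y in lborel. y \<in> {c..d} \<longrightarrow> rep_lsq (lookup (fst (snd (snd (P u)))) i) y =
        indicat_real {c..d} y * pi4_fin a b (n0, n1) (B21 K) (p1 u) i +
        indicat_real {c..d} y * pi4_fin a b (n2, n3) (N0 K) (p2 u y) i +
        indicat_real {c..d} y * (LINT \<nu>:{c..y}|lborel. pi4_fin a b (n2, n3) (N1 K) (p2 u \<nu>) i) +
        indicat_real {c..d} y * (LINT \<nu>:{y..d}|lborel. pi4_fin a b (n2, n3) (N2 K) (p2 u \<nu>) i)"
      by eventually_elim simp
  qed
  have w3: "bounded_linear_on ?V (\<lambda>u. lookup (snd (snd (snd (P u)))) i)" if i: "i < m3" for i
  proof (rule bounded_linear_on_lsq[OF V])
    \<comment> \<open>The factors \<open>indicat_real {a..b} x\<close> and \<open>indicat_real {c..d} y\<close> equal 1 on the rectangle.\<close>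
    let ?d1 = "\<lambda>u x. indicat_real {a..b} x * pi4_dist a b (n0, n1) (B21 K) (p1 u) i x"
    let ?d2 = "\<lambda>Q u x y. indicat_real {a..b} x * pi4_dist a b (n2, n3) Q (p2 u y) i x"
    let ?F = "\<lambda>u z. indicat_real {c..d} (snd z) * ?d1 u (fst z) +
        indicat_real {c..d} (snd z) * ?d2 (N0 K) u (fst z) (snd z) +
        indicat_real {c..d} (snd z) * (LINT \<nu>:{c..snd z}|lborel. ?d2 (N1 K) u (fst z) \<nu>) +
        indicat_real {c..d} (snd z) * (LINT \<nu>:{snd z..d}|lborel. ?d2 (N2 K) u (fst z) \<nu>)"
    show "L2_map ?V lborel pt (\<lambda>u z _. ?F u z)"
      by (rule L2_map_pair_pt, unfold fst_conv snd_conv)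
        (intro L2_map_add
          L2_map_const_right[OF V sigma_finite_lborel dist1[OF valid(3) i]]
          L2_map_cut_right[OF V sigma_finite_lborel dist2[OF valid(4) i]]
          L2_map_integral_below[OF V sigma_finite_lborel dist2[OF valid(5) i]]
          L2_map_integral_above[OF V sigma_finite_lborel dist2[OF valid(6) i]])
    fix u assume u: "u \<in> ?V"
    show "lookup (snd (snd (snd (P u)))) i \<in> lsq_on ({a..b} \<times> {c..d})"
      using PZ'(4)[OF u] i by (simp add: vecs_def)
    have "AE (x, y) in lborel. (x, y) \<in> {a..b} \<times> {c..d} \<longrightarrow>
        rep_lsq (lookup (snd (snd (snd (P u)))) i) (x, y) =
        pi4_dist a b (n0, n1) (B21 K) (p1 u) i x + pi4_dist a b (n2, n3) (N0 K) (p2 u y) i x +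
        (LINT \<nu>:{c..y}|lborel. pi4_dist a b (n2, n3) (N1 K) (p2 u \<nu>) i x) +
        (LINT \<nu>:{y..d}|lborel. pi4_dist a b (n2, n3) (N2 K) (p2 u \<nu>) i x)"
      using out[OF u] i by blast
    then show "AE z in lborel. z \<in> {a..b} \<times> {c..d} \<longrightarrow>
        rep_lsq (lookup (snd (snd (snd (P u)))) i) z = ?F u z"
      by eventually_elim auto
  qed
  have keys: "keys f \<subseteq> {..<k}" if "f \<in> vecs k X" for f :: "nat \<Rightarrow>\<^sub>0 'a::real_inner" and k X
    using that by (simp add: vecs_def)
  have "bounded_linear_on ?V (\<lambda>u. (fst (P u), fst (snd (P u)), fst (snd (snd (P u))), snd (snd (snd (P u)))))"
    by (intro bounded_linear_on_Pair)
      (rule bounded_linear_on_poly_mapping[OF V finite_lessThan], rule keys[OF PZ'(1)], assumption,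
        simp only: lessThan_iff w0,
       rule bounded_linear_on_poly_mapping[OF V finite_lessThan], rule keys[OF PZ'(2)], assumption,
        simp only: lessThan_iff w1,
       rule bounded_linear_on_poly_mapping[OF V finite_lessThan], rule keys[OF PZ'(3)], assumption,
        simp only: lessThan_iff w2,
       rule bounded_linear_on_poly_mapping[OF V finite_lessThan], rule keys[OF PZ'(4)], assumption,
        simp only: lessThan_iff w3)
  then show ?thesis by (simp add: nm)
qed


section \<open>Time derivatives\<close>

text \<open>Derivatives on \<open>{0..}\<close> are unique, also the one-sided derivative at 0.\<close>

lemma at_within_nonneg_neq_bot: "0 \<le> t \<Longrightarrow> at t within {0..} \<noteq> (bot :: real filter)"
proof
  assume t: "0 \<le> t" and "at t within {0..} = bot"
  moreover have "at_right t \<le> at t within {0..}"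
    using t by (intro at_le) auto
  ultimately show False
    using trivial_limit_at_right_real[of t] by (simp add: bot_unique)
qed

lemma time_deriv_works:
  assumes "v differentiable_on {0..}" "0 \<le> t"
  shows "(v has_vector_derivative time_deriv v t) (at t within {0..})"
  using assms unfolding time_deriv_def differentiable_on_def
  by (auto simp: vector_derivative_works[symmetric])

lemma time_deriv_eqI:
  "0 \<le> t \<Longrightarrow> (v has_vector_derivative v') (at t within {0..}) \<Longrightarrow> time_deriv v t = v'"
  unfolding time_deriv_def by (rule vector_derivative_within[OF at_within_nonneg_neq_bot])

lemma differentiable_onI_vector_derivative:
  "(\<And>t. 0 \<le> t \<Longrightarrow> (v has_vector_derivative v' t) (at t within {0..})) \<Longrightarrow> v differentiable_on {0..}"
  unfolding differentiable_on_def by (auto intro: differentiableI_vector)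

lemma differentiable_on_bounded_linear:
  fixes v :: "real \<Rightarrow> zspace"
  assumes f: "bounded_linear f" and v: "v differentiable_on {0..}"
  shows "(\<lambda>t. f (v t)) differentiable_on {0..}"
  by (rule differentiable_onI_vector_derivative[OF
        bounded_linear.has_vector_derivative[OF f time_deriv_works[OF v]]])

lemma
  assumes v: "\<forall>t\<ge>0. v t \<in> Z a b c d n" and d: "v differentiable_on {0..}" and t: "0 \<le> t"
  shows time_deriv_in_Z: "time_deriv v t \<in> Z a b c d n"
    and bounded_linear_on_has_time_deriv: "bounded_linear_on (Z a b c d n) f \<Longrightarrow>
      ((\<lambda>t. f (v t)) has_vector_derivative f (time_deriv v t)) (at t within {0..})"
proof -
  have t': "t \<in> {0..}" and v': "s \<in> {0..} \<Longrightarrow> v s \<in> Z a b c d n" for s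
    using v t by auto
  note deriv = subspace_Z closed_Z t' at_within_nonneg_neq_bot[OF t]
  note vt = v' time_deriv_works[OF d t]
  show "time_deriv v t \<in> Z a b c d n"
    by (rule has_vector_derivative_in_closed_subspace[OF deriv vt])
  show "((\<lambda>t. f (v t)) has_vector_derivative f (time_deriv v t)) (at t within {0..})"
    if "bounded_linear_on (Z a b c d n) f"
    by (rule bounded_linear_on_has_vector_derivative[OF deriv that vt])
qed

lemma differentiable_on_nonneg_cong:
  fixes f g :: "real \<Rightarrow> zspace"
  assumes "\<And>t. 0 \<le> t \<Longrightarrow> f t = g t" "g differentiable_on {0..}"
  shows "f differentiable_on {0..}"
  unfolding differentiable_on_def
proof
  fix t :: real assume t: "t \<in> {0..}"
  show "f differentiable (at t within {0..})"
  proof (rule differentiable_transform_within[where f = g and d = 1])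
    show "g differentiable (at t within {0..})"
      using assms(2) t by (simp add: differentiable_on_def)
  qed (use assms(1) t in auto)
qed

lemma time_deriv_z_join:
  assumes "v differentiable_on {0..}" "w differentiable_on {0..}" "0 \<le> t"
  shows "((\<lambda>t. z_join n (v t) (w t)) has_vector_derivative
      z_join n (time_deriv v t) (time_deriv w t)) (at t within {0..})"
  using bounded_linear.has_vector_derivative[OF bounded_linear_z_join[of n]
      has_vector_derivative_Pair[OF time_deriv_works[OF assms(1,3)] time_deriv_works[OF assms(2,3)]]]
  by simp

text \<open>
  Joining is bounded and linear, and so are the projections that undo it. Joining truncates its first
  argument to the lengths \<open>n\<close>, so \<open>v\<close> can be recovered only if it lies in \<open>Z\<close>.
\<close>

lemma z_join_differentiable_iff:
  fixes v w :: "real \<Rightarrow> zspace"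
  assumes v: "\<forall>t\<ge>0. v t \<in> Z a b c d n"
  shows "(\<lambda>t. z_join n (v t) (w t)) differentiable_on {0..} \<longleftrightarrow>
      v differentiable_on {0..} \<and> w differentiable_on {0..}"
    (is "?j differentiable_on _ \<longleftrightarrow> _")
proof
  assume j: "?j differentiable_on {0..}"
  have "(\<lambda>t. z_fst n (?j t)) differentiable_on {0..}" "(\<lambda>t. z_snd n (?j t)) differentiable_on {0..}"
    by (rule differentiable_on_bounded_linear[OF bounded_linear_z_fst j]
        differentiable_on_bounded_linear[OF bounded_linear_z_snd j])+
  moreover from this(1) have "v differentiable_on {0..}"
    by (rule differentiable_on_nonneg_cong[rotated]) (use v z_fst_join in metis)
  ultimately show "v differentiable_on {0..} \<and> w differentiable_on {0..}"
    by (simp add: z_snd_join)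
next
  assume vw: "v differentiable_on {0..} \<and> w differentiable_on {0..}"
  show "?j differentiable_on {0..}"
    by (rule differentiable_onI_vector_derivative[OF time_deriv_z_join]) (use vw in auto)
qed


section \<open>The interconnection of two PIEs\<close>

theorem proposition9:
  fixes a b c d :: real
    and n1 n2 np nq :: dims
    and T1 Tp A1 Bp Cq Dqp T2 Tq A2 Bq Cp :: "zspace \<Rightarrow> zspace"
    and G1 G2 :: pie
    and T A :: "zspace \<Rightarrow> zspace"
    and v \<psi> p q :: "real \<Rightarrow> zspace"
    and v0 \<psi>0 :: zspace
  assumes "a \<le> b" and "c \<le> d"
    and "pi_operator a b c d n1 n1 T1" and "pi_operator a b c d n1 n1 A1"
    and "pi_operator a b c d np n1 Tp" and "pi_operator a b c d np n1 Bp"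
    and "pi_operator a b c d n1 nq Cq" and "pi_operator a b c d np nq Dqp"
    and "pi_operator a b c d n2 n2 T2" and "pi_operator a b c d n2 n2 A2"
    and "pi_operator a b c d nq n2 Tq" and "pi_operator a b c d nq n2 Bq"
    and "pi_operator a b c d n2 np Cp"
    and "G1 = \<lparr>op_T = T1, op_Tp = Tp, op_A = A1, op_B = Bp, op_C = Cq, op_D = Dqp\<rparr>"
    and "G2 = \<lparr>op_T = T2, op_Tp = Tq, op_A = A2, op_B = Bq, op_C = Cp, op_D = (\<lambda>_. 0)\<rparr>"
    and "T = z_block n1 T1 (Tp \<circ> Cp) (Tq \<circ> Cq) (\<lambda>z. T2 z + Tq (Dqp (Cp z)))"
    and "A = z_block n1 A1 (Bp \<circ> Cp) (Bq \<circ> Cq) (\<lambda>z. A2 z + Bq (Dqp (Cp z)))"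
    and "\<forall>t\<ge>0. v t \<in> Z a b c d n1" and "\<forall>t\<ge>0. \<psi> t \<in> Z a b c d n2"
    and "v0 \<in> Z a b c d n1" and "\<psi>0 \<in> Z a b c d n2"
    and "\<forall>t\<ge>0. p t = Cp (\<psi> t)" and "\<forall>t\<ge>0. q t = Cq (v t) + Dqp (p t)"
  shows "autonomous_pie_solution a b c d (n1 + n2) T A (z_join n1 v0 \<psi>0) (\<lambda>t. z_join n1 (v t) (\<psi> t))
     \<longleftrightarrow> pie_solution a b c d n1 np nq G1 p v0 v q \<and> pie_solution a b c d n2 nq np G2 q \<psi>0 \<psi> p"
proof -
  note op = assms(3-13) and G = assms(14,15) and TA = assms(16,17) and v = assms(18)
    and \<psi> = assms(19) and v0 = assms(20) and p = assms(22) and q = assms(23)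
  note lin = op[THEN pi_operator_bounded_linear_on] and maps = op[THEN pi_operator_maps]
  have add: "P (u + w) = P u + P w"
    if "pi_operator a b c d n m P" "u \<in> Z a b c d n" "w \<in> Z a b c d n" for P n m u w
  proof -
    have "P (u + 1 *\<^sub>R w) = P u + 1 *\<^sub>R P w"
      using pi_operator_bounded_linear_on[OF that(1)] that(2,3) unfolding bounded_linear_on_def by blast
    then show ?thesis by simp
  qed
  have plus: "u + w \<in> Z a b c d n" if "u \<in> Z a b c d n" "w \<in> Z a b c d n" for u w n
    by (rule subspace_add[OF subspace_Z that])
  have pZ: "\<forall>t\<ge>0. p t \<in> Z a b c d np"
    using p \<psi> maps(11) by simp
  have qZ: "\<forall>t\<ge>0. q t \<in> Z a b c d nq"
    using q v pZ maps(5,6) plus by simp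
  have jZ: "\<forall>t\<ge>0. z_join n1 (v t) (\<psi> t) \<in> Z a b c d (n1 + n2)"
    using v \<psi> z_join_in_Z by blast
  \<comment> \<open>Linearity of \<open>Q\<close> collects the second row of the block operator into \<open>Q\<close> applied to the output of the first system.\<close>
  have block_eq: "z_block n1 P11 (P \<circ> Cp) (Q \<circ> Cq) (\<lambda>z. P22 z + Q (Dqp (Cp z))) (z_join n1 u w) =
      z_join n1 (P11 u + P (Cp w)) (P22 w + Q (Cq u + Dqp (Cp w)))"
    if "pi_operator a b c d nq n2 Q" "u \<in> Z a b c d n1" "w \<in> Z a b c d n2" for P11 P Q P22 u w
    using add[OF that(1), of "Cq u" "Dqp (Cp w)"] that maps
    by (simp add: z_block_def z_fst_join z_snd_join algebra_simps)
  \<comment> \<open>The dynamics agree pointwise in time, because \<open>p\<close> and \<open>q\<close> inherit their derivatives from \<open>v\<close> and \<open>\<psi>\<close>.\<close>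
  have dyn: "p differentiable_on {0..} \<and> q differentiable_on {0..} \<and>
      (\<forall>t\<ge>0. T (time_deriv (\<lambda>t. z_join n1 (v t) (\<psi> t)) t) = A (z_join n1 (v t) (\<psi> t)) \<longleftrightarrow>
        Tp (time_deriv p t) + T1 (time_deriv v t) = A1 (v t) + Bp (p t) \<and>
        Tq (time_deriv q t) + T2 (time_deriv \<psi> t) = A2 (\<psi> t) + Bq (q t))"
    if dv: "v differentiable_on {0..}" and d\<psi>: "\<psi> differentiable_on {0..}"
  proof -
    have hp: "(p has_vector_derivative Cp (time_deriv \<psi> t)) (at t within {0..})" if "0 \<le> t" for t
      by (rule has_vector_derivative_transform[OF _ _
            bounded_linear_on_has_time_deriv[OF \<psi> d\<psi> that lin(11)]])
        (use p that in auto)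
    have dp: "p differentiable_on {0..}"
      by (rule differentiable_onI_vector_derivative[OF hp])
    have p': "time_deriv p t = Cp (time_deriv \<psi> t)" if "0 \<le> t" for t
      by (rule time_deriv_eqI[OF that hp[OF that]])
    have hq: "(q has_vector_derivative Cq (time_deriv v t) + Dqp (Cp (time_deriv \<psi> t)))
        (at t within {0..})" if "0 \<le> t" for t
      by (rule has_vector_derivative_transform[OF _ _ has_vector_derivative_add[OF
            bounded_linear_on_has_time_deriv[OF v dv that lin(5)]
            bounded_linear_on_has_time_deriv[OF pZ dp that lin(6), unfolded p'[OF that]]]])
        (use q that in auto)
    have dq: "q differentiable_on {0..}"
      by (rule differentiable_onI_vector_derivative[OF hq])
    have q': "time_deriv q t = Cq (time_deriv v t) + Dqp (Cp (time_deriv \<psi> t))" if "0 \<le> t" for t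
      by (rule time_deriv_eqI[OF that hq[OF that]])
    have "T (time_deriv (\<lambda>t. z_join n1 (v t) (\<psi> t)) t) = A (z_join n1 (v t) (\<psi> t)) \<longleftrightarrow>
        Tp (time_deriv p t) + T1 (time_deriv v t) = A1 (v t) + Bp (p t) \<and>
        Tq (time_deriv q t) + T2 (time_deriv \<psi> t) = A2 (\<psi> t) + Bq (q t)" if t: "0 \<le> t" for t
    proof -
      have Z': "time_deriv v t \<in> Z a b c d n1" "time_deriv \<psi> t \<in> Z a b c d n2"
        using time_deriv_in_Z[OF v dv t] time_deriv_in_Z[OF \<psi> d\<psi> t] .
      have Zt: "v t \<in> Z a b c d n1" "\<psi> t \<in> Z a b c d n2" using v \<psi> t by auto
      have j': "time_deriv (\<lambda>t. z_join n1 (v t) (\<psi> t)) t = z_join n1 (time_deriv v t) (time_deriv \<psi> t)"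
        by (rule time_deriv_eqI[OF t time_deriv_z_join[OF dv d\<psi> t]])
      have in1: "T1 (time_deriv v t) + Tp (Cp (time_deriv \<psi> t)) \<in> Z a b c d n1"
        "A1 (v t) + Bp (Cp (\<psi> t)) \<in> Z a b c d n1"
        by (intro plus maps Z' Zt)+
      show ?thesis
        unfolding j' TA block_eq[OF op(9) Z'] block_eq[OF op(10) Zt] z_join_inject[OF in1]
          p'[OF t] q'[OF t] q[rule_format, OF t] p[rule_format, OF t]
        by (simp add: add.commute)
    qed
    with dp dq show ?thesis by blast
  qed
  have init: "z_join n1 (v 0) (\<psi> 0) = z_join n1 v0 \<psi>0 \<longleftrightarrow> v 0 = v0 \<and> \<psi> 0 = \<psi>0"
    using z_join_inject[of "v 0" a b c d n1 v0] v v0 by simp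
  show ?thesis
  proof (cases "v differentiable_on {0..} \<and> \<psi> differentiable_on {0..}")
    case True
    then show ?thesis
      using dyn v \<psi> pZ qZ jZ p q
      unfolding autonomous_pie_solution_def pie_solution_def G pie.simps
        z_join_differentiable_iff[OF v] init by (simp, blast)
  next
    case False
    then show ?thesis
      unfolding autonomous_pie_solution_def pie_solution_def z_join_differentiable_iff[OF v] by blast
  qed
qed

end
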